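(* Let $T>0$, $r\ge 0$ and $g:\mathcal I\to\mathbb R$. Let $(V^{T,r}_i)_{i\in\mathcal I}$ be the unique continuously differentiable solution on $(-\infty,T]$ of $$\frac{d}{dt}V^{T,r}_i(t)-rV^{T,r}_i(t)+H\Big(i,\big(V^{T,r}_j(t)-V^{T,r}_i(t)\big)_{j\in\mathcal V(i)}\Big)=0,\qquad V^{T,r}_i(T)=g(i),\qquad i\in\mathcal I.$$ Then: (1) For all $(i,t)\in\mathcal I\times[0,T]$, $u^{T,r}_i(t)=V^{T,r}_i(t)$. (2) Optimal controls for the problem $$\sup_{\lambda\in\mathcal A^T_0}\mathbb E\left[-\int_0^Te^{-rt}L\Big(X^{0,i,\lambda}_t,\big(\lambda_t(X^{0,i,\lambda}_t,j)\big)_{j\in\mathcal V(X^{0,i,\lambda}_t)}\Big)dt+e^{-rT}g\big(X^{0,i,\lambda}_T\big)\right]$$ (for any starting node $i\in\mathcal I$) are given by any feedback control $\lambda^*\in\mathcal A^T_0$ verifying, for all $k\in\mathcal I$ and all $t\in[0,T]$, $$\big(\lambda^*_t(k,j)\big)_{j\in\mathcal V(k)}\in\underset{(\lambda_{kj})_{j\in\mathcal V(k)}\in\mathbb R_+^{|\mathcal V(k)|}}{\operatorname{argmax}}\left(\Big(\sum_{j\in\mathcal V(k)}\lambda_{kj}\big(u^{T,r}_j(t)-u^{T,r}_k(t)\big)\Big)-L\big(k,(\lambda_{kj})_{j\in\mathcal V(k)}\big)\right),$$ that is, any such $\lambda^*$ attains the supremum.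
   Context: $\mathcal I=\{1,\dots,N\}$ is the set of nodes of a finite strongly connected directed graph $\mathcal G$ (for any two nodes $i,j$ there is a directed path from $i$ to $j$). For $i\in\mathcal I$, $\mathcal V(i)\subset\mathcal I\setminus\{i\}$ is the set of nodes $j$ for which there is a directed edge from $i$ to $j$. $\mathbb R_+=[0,\infty)$, $\mathbb R_+^*=(0,\infty)$. For each $i\in\mathcal I$ a cost function $L(i,\cdot):\mathbb R_+^{|\mathcal V(i)|}\to\mathbb R\cup\{+\infty\}$ is given, with: (A1) for every $i$ there is a tuple $(\lambda_{ij})_{j\in\mathcal V(i)}$ with all entries in $\mathbb R_+^*$ such that $L(i,(\lambda_{ij})_j)<+\infty$; (A2) each $L(i,\cdot)$ is lower semi-continuous; (A3) there is $\underline C\in\mathbb R$ with $L(i,\lambda)\ge\underline C$ for all $i$ and all $\lambda\in\mathbb R_+^{|\mathcal V(i)|}$; (A4) for every $i$, $L(i,\lambda)/\|\lambda\|_\infty\to+\infty$ as $\|\lambda\|_\infty\to+\infty$. The Hamiltonian functions are $H(i,p)=\sup_{\lambda\in\mathbb R_+^{|\mathcal V(i)|}}\big(\sum_{j\in\mathcal V(i)}\lambda_{j}p_j-L(i,\lambda)\big)$ for $p\in\mathbb R^{|\mathcal V(i)|}$; they are real-valued. All processes are defined on a filtered probability space satisfying the usual conditions and are adapted. For $t\in[0,T]$, $\mathcal A^T_t$ is the set of families $(\lambda_s(i,j))_{s\in[t,T],i\in\mathcal I,j\in\mathcal V(i)}$ of non-negative deterministic functions with $s\mapsto\lambda_s(i,j)\in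 L^1(t,T)$ for all $i\in\mathcal I$, $j\in\mathcal V(i)$. For $\lambda\in\mathcal A^T_t$, $(X^{t,i,\lambda}_s)_{s\in[t,T]}$ is the continuous-time Markov chain on $\mathcal I$ starting from node $i$ at time $t$ whose instantaneous transition rate at time $s$ from node $k$ to node $j\in\mathcal V(k)$ is $\lambda_s(k,j)$. The value functions are, for $i\in\mathcal I$, $t\in[0,T]$, $$u^{T,r}_i(t)=\sup_{\lambda\in\mathcal A^T_t}\mathbb E\left[-\int_t^Te^{-r(s-t)}L\Big(X^{t,i,\lambda}_s,\big(\lambda_s(X^{t,i,\lambda}_s,j)\big)_{j\in\mathcal V(X^{t,i,\lambda}_s)}\Big)ds+e^{-r(T-t)}g\big(X^{t,i,\lambda}_T\big)\right].$$ *)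

theory Defs
  imports "HOL-Probability.Probability"
begin

text \<open>
  The nodes are the elements of a finite type \<^typ>\<open>'i\<close>, and \<open>\<V> k\<close> is the set of nodes \<open>j\<close> such
  that there is an edge from \<open>k\<close> to \<open>j\<close>.
\<close>

definition strongly_connected_digraph :: "('i \<Rightarrow> 'i set) \<Rightarrow> bool" where
  "strongly_connected_digraph \<V> \<longleftrightarrow>
     (\<forall>i. i \<notin> \<V> i) \<and> (\<forall>i j. (i, j) \<in> {(k, l). l \<in> \<V> k}\<^sup>*)"

text \<open>
  The orthant of nonnegative tuples indexed by a set \<open>A\<close> of nodes is represented by functions that
  are \<^const>\<open>undefined\<close> off \<open>A\<close>, so that it is in bijection with (and, for the product topology on
  the function type, homeomorphic to) the usual orthant.
\<close>

definition orthant :: "'i set \<Rightarrow> ('i \<Rightarrow> real) set" where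
  "orthant A = A \<rightarrow>\<^sub>E {0..}"

text \<open>Inserting \<open>0\<close> only matters for the empty index set (a graph with a single node).\<close>

definition sup_norm_on :: "'i set \<Rightarrow> ('i \<Rightarrow> real) \<Rightarrow> real" where
  "sup_norm_on A x = Max (insert 0 ((\<lambda>j. \<bar>x j\<bar>) ` A))"

definition lower_semicontinuous_on :: "'a::topological_space set \<Rightarrow> ('a \<Rightarrow> ereal) \<Rightarrow> bool" where
  "lower_semicontinuous_on S f \<longleftrightarrow> (\<forall>x\<in>S. f x \<le> Liminf (at x within S) f)"

text \<open>
  In the last clause, the filter describes tuples of the orthant whose norm tends to infinity.
\<close>

definition admissible_cost ::
  "('i::finite \<Rightarrow> 'i set) \<Rightarrow> ('i \<Rightarrow> ('i \<Rightarrow> real) \<Rightarrow> ereal) \<Rightarrow> bool" where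
  "admissible_cost \<V> L \<longleftrightarrow>
     (\<forall>i. \<forall>x\<in>orthant (\<V> i). L i x \<noteq> -\<infinity>) \<and>
     (\<forall>i. \<exists>x \<in> \<V> i \<rightarrow>\<^sub>E {0<..}. L i x < \<infinity>) \<and>
     (\<forall>i. lower_semicontinuous_on (orthant (\<V> i)) (L i)) \<and>
     (\<exists>C::real. \<forall>i. \<forall>x\<in>orthant (\<V> i). ereal C \<le> L i x) \<and>
     (\<forall>i. ((\<lambda>x. L i x / ereal (sup_norm_on (\<V> i) x)) \<longlongrightarrow> \<infinity>)
            (inf (filtercomap (sup_norm_on (\<V> i)) at_top) (principal (orthant (\<V> i)))))"

definition hamiltonian ::
  "('i::finite \<Rightarrow> 'i set) \<Rightarrow> ('i \<Rightarrow> ('i \<Rightarrow> real) \<Rightarrow> ereal) \<Rightarrow> 'i \<Rightarrow> ('i \<Rightarrow> real) \<Rightarrow> ereal" where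
  "hamiltonian \<V> L i p = (SUP x\<in>orthant (\<V> i). ereal (\<Sum>j\<in>\<V> i. x j * p j) - L i x)"

text \<open>
  The Hamiltonian is real-valued for admissible costs; stating the equation in \<^typ>\<open>ereal\<close> avoids a
  conversion that would turn infinite values into \<open>0\<close>.
\<close>

definition hjb_solution ::
  "('i::finite \<Rightarrow> 'i set) \<Rightarrow> ('i \<Rightarrow> ('i \<Rightarrow> real) \<Rightarrow> ereal) \<Rightarrow> real \<Rightarrow> real \<Rightarrow> ('i \<Rightarrow> real) \<Rightarrow>
     ('i \<Rightarrow> real \<Rightarrow> real) \<Rightarrow> bool" where
  "hjb_solution \<V> L T r g V \<longleftrightarrow>
     (\<exists>V'. \<forall>i. continuous_on {..T} (V' i) \<and>
        (\<forall>t\<le>T. (V i has_real_derivative V' i t) (at t within {..T}) \<and>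
                ereal (V' i t - r * V i t) + hamiltonian \<V> L i (\<lambda>j. V j t - V i t) = 0)) \<and>
     (\<forall>i. V i T = g i)"

text \<open>
  \<open>lam s i j\<close> is the rate at time \<open>s\<close> from \<open>i\<close> to \<open>j\<close>; only \<open>s\<close> in \<open>{t..T}\<close> and \<open>j\<close> in \<open>\<V> i\<close> matter.
\<close>

definition controls ::
  "('i::finite \<Rightarrow> 'i set) \<Rightarrow> real \<Rightarrow> real \<Rightarrow> (real \<Rightarrow> 'i \<Rightarrow> 'i \<Rightarrow> real) set" where
  "controls \<V> t T =
     {lam. \<forall>i. \<forall>j\<in>\<V> i. (\<forall>s\<in>{t..T}. 0 \<le> lam s i j) \<and>
                          (\<lambda>s. lam s i j) absolutely_integrable_on {t..T}}"

text \<open>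
  Time is indexed by \<^typ>\<open>real\<close>, but the usual conditions are imposed at nonnegative times only: a
  filtration indexed by nonnegative times extends to negative times by its value at \<open>0\<close>. The last
  clause says that \<open>F s\<close> contains all subsets of null sets of \<open>M\<close>.
\<close>

definition usual_filtration :: "'w measure \<Rightarrow> (real \<Rightarrow> 'w measure) \<Rightarrow> bool" where
  "usual_filtration M F \<longleftrightarrow>
     filtration (space M) F \<and> (\<forall>s. subalgebra M (F s)) \<and>
     (\<forall>s\<ge>0. sets (F s) = (\<Inter>u\<in>{s<..}. sets (F u))) \<and>
     (\<forall>s\<ge>0. \<forall>A\<in>null_sets M. \<forall>B\<subseteq>A. B \<in> sets (F s))"

definition cadlag_discrete_on :: "real \<Rightarrow> real \<Rightarrow> (real \<Rightarrow> 'i) \<Rightarrow> bool" where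
  "cadlag_discrete_on t T x \<longleftrightarrow>
     (\<forall>s\<in>{t..<T}. \<forall>\<^sub>F u in at_right s. x u = x s) \<and>
     (\<forall>s\<in>{t<..T}. \<exists>k. \<forall>\<^sub>F u in at_left s. x u = k)"

definition rate_matrix ::
  "('i::finite \<Rightarrow> 'i set) \<Rightarrow> (real \<Rightarrow> 'i \<Rightarrow> 'i \<Rightarrow> real) \<Rightarrow> real \<Rightarrow> 'i \<Rightarrow> 'i \<Rightarrow> real" where
  "rate_matrix \<V> lam s k j =
     (if j = k then - (\<Sum>l\<in>\<V> k. lam s k l) else if j \<in> \<V> k then lam s k j else 0)"

text \<open>
  \<open>P s u k j\<close> is the probability of being in \<open>j\<close> at time \<open>u\<close> given that the chain is in \<open>k\<close> at
  time \<open>s\<close>. As the rates are merely integrable in time, ``\<open>P\<close> has instantaneous rates \<open>lam\<close>'' is the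
  forward equation in integrated form: \<open>P s u k j\<close> is absolutely continuous in \<open>u\<close>, with derivative
  \<open>\<Sum>l. P s u k l * rate_matrix \<V> lam u l j\<close> at almost every \<open>u\<close>. For given rates this
  determines \<open>P\<close>.
\<close>

definition transition_function ::
  "('i::finite \<Rightarrow> 'i set) \<Rightarrow> real \<Rightarrow> real \<Rightarrow> (real \<Rightarrow> 'i \<Rightarrow> 'i \<Rightarrow> real) \<Rightarrow>
     (real \<Rightarrow> real \<Rightarrow> 'i \<Rightarrow> 'i \<Rightarrow> real) \<Rightarrow> bool" where
  "transition_function \<V> t T lam P \<longleftrightarrow>
     (\<forall>s u k. t \<le> s \<and> s \<le> u \<and> u \<le> T \<longrightarrow>
        (\<forall>j. 0 \<le> P s u k j) \<and> (\<Sum>j\<in>UNIV. P s u k j) = 1 \<and>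
        (\<forall>j. (\<lambda>v. \<Sum>l\<in>UNIV. P s v k l * rate_matrix \<V> lam v l j) absolutely_integrable_on {s..u} \<and>
             P s u k j = of_bool (k = j) +
               integral {s..u} (\<lambda>v. \<Sum>l\<in>UNIV. P s v k l * rate_matrix \<V> lam v l j)))"

text \<open>
  The last clause is the Markov property relative to \<open>F\<close>, with transition probabilities \<open>P\<close>.
\<close>

definition markov_chain_on ::
  "'w measure \<Rightarrow> (real \<Rightarrow> 'w measure) \<Rightarrow> ('i::finite \<Rightarrow> 'i set) \<Rightarrow> real \<Rightarrow> real \<Rightarrow> 'i \<Rightarrow>
     (real \<Rightarrow> 'i \<Rightarrow> 'i \<Rightarrow> real) \<Rightarrow> (real \<Rightarrow> 'w \<Rightarrow> 'i) \<Rightarrow> bool" where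
  "markov_chain_on M F \<V> t T i lam X \<longleftrightarrow>
     (\<forall>s\<in>{t..T}. X s \<in> F s \<rightarrow>\<^sub>M count_space UNIV) \<and>
     (AE \<omega> in M. cadlag_discrete_on t T (\<lambda>s. X s \<omega>)) \<and>
     (AE \<omega> in M. X t \<omega> = i) \<and>
     (\<exists>P. transition_function \<V> t T lam P \<and>
        (\<forall>s u j. t \<le> s \<and> s \<le> u \<and> u \<le> T \<longrightarrow>
           (AE \<omega> in M. real_cond_exp M (F s) (indicat_real {\<omega>' \<in> space M. X u \<omega>' = j}) \<omega>
                        = P s u (X s \<omega>) j)))"

text \<open>
  Lebesgue integral of an extended real-valued function as positive part minus negative part
  (\<^const>\<open>e2ennreal\<close> maps negative numbers to \<open>0\<close>). It is only meaningful when one of the two parts is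
  finite. Below this is always the case: costs are bounded from below and \<open>T\<close> is finite, so the
  running cost has finite negative part and the payoff is bounded from above.
\<close>

definition quasi_integral :: "'a measure \<Rightarrow> ('a \<Rightarrow> ereal) \<Rightarrow> ereal" where
  "quasi_integral M f =
     enn2ereal (\<integral>\<^sup>+ x. e2ennreal (f x) \<partial>M) - enn2ereal (\<integral>\<^sup>+ x. e2ennreal (- f x) \<partial>M)"

text \<open>
  In the next two definitions \<open>X t i lam\<close> is the chain started from \<open>i\<close> at time \<open>t\<close> and controlled
  by \<open>lam\<close>.
\<close>

definition expected_payoff ::
  "'w measure \<Rightarrow> ('i::finite \<Rightarrow> 'i set) \<Rightarrow> ('i \<Rightarrow> ('i \<Rightarrow> real) \<Rightarrow> ereal) \<Rightarrow>
     (real \<Rightarrow> 'i \<Rightarrow> (real \<Rightarrow> 'i \<Rightarrow> 'i \<Rightarrow> real) \<Rightarrow> real \<Rightarrow> 'w \<Rightarrow> 'i) \<Rightarrow>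
     real \<Rightarrow> real \<Rightarrow> ('i \<Rightarrow> real) \<Rightarrow> 'i \<Rightarrow> real \<Rightarrow> (real \<Rightarrow> 'i \<Rightarrow> 'i \<Rightarrow> real) \<Rightarrow> ereal" where
  "expected_payoff M \<V> L X T r g i t lam =
     quasi_integral M (\<lambda>\<omega>.
       - quasi_integral (lebesgue_on {t..T}) (\<lambda>s.
            ereal (exp (- r * (s - t))) *
            L (X t i lam s \<omega>) (\<lambda>j\<in>\<V> (X t i lam s \<omega>). lam s (X t i lam s \<omega>) j))
       + ereal (exp (- r * (T - t)) * g (X t i lam T \<omega>)))"

definition value_function ::
  "'w measure \<Rightarrow> ('i::finite \<Rightarrow> 'i set) \<Rightarrow> ('i \<Rightarrow> ('i \<Rightarrow> real) \<Rightarrow> ereal) \<Rightarrow>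
     (real \<Rightarrow> 'i \<Rightarrow> (real \<Rightarrow> 'i \<Rightarrow> 'i \<Rightarrow> real) \<Rightarrow> real \<Rightarrow> 'w \<Rightarrow> 'i) \<Rightarrow>
     real \<Rightarrow> real \<Rightarrow> ('i \<Rightarrow> real) \<Rightarrow> 'i \<Rightarrow> real \<Rightarrow> ereal" where
  "value_function M \<V> L X T r g i t =
     (SUP lam\<in>controls \<V> t T. expected_payoff M \<V> L X T r g i t lam)"

end

theory Submission
  imports Defs
begin

text \<open>
  For a fixed control, the expected payoff depends on the chain only through its one-dimensional
  marginals \<open>p\<close>, which solve the forward equation. Pairing \<open>p\<close> with the discounted solution
  \<open>exp (- r (s - t)) V\<close> of the Hamilton-Jacobi equation and integrating by parts expresses \<open>V i t\<close>
  as the payoff in which the cost \<open>L\<close> is replaced by \<open>\<Sum>j. \<lambda> j (V j - V k) - H k\<close>. This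
  quantity is at most \<open>L\<close> by definition of the Hamiltonian, with equality exactly at maximisers;
  hence no control beats \<open>V\<close>, pointwise maximising controls attain it, and nearly maximising
  controls come arbitrarily close to it.
\<close>

subsection \<open>Quasi-integrals, semicontinuous functions and integration by parts\<close>

text \<open>Each control has its own chain \<open>X t i lam\<close>, and nothing relates two of
  these chains. Passing to marginals removes this difficulty, because the bounds hold for any
  marginals that obey the forward equation of the control. Two kinds of roughness shape the rest.
  The cost may be \<open>\<infinity>\<close> and the payoff \<open>-\<infinity>\<close>, so Fubini
  for integrable functions does not apply to the payoff. A constant \<open>c\<close> that makes the
  running cost nonnegative is added, integrals are exchanged in \<open>ennreal\<close>, and the
  constant is removed at the end. The rates are merely integrable in time, so the marginals are only
  absolutely continuous, and the product rule is replaced by a Fubini argument on a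
  triangle.\<close>

lemma quasi_integral_cong_AE:
  assumes "AE x in M. f x = h x"
  shows "quasi_integral M f = quasi_integral M h"
proof -
  have "(\<integral>\<^sup>+ x. e2ennreal (f x) \<partial>M) = (\<integral>\<^sup>+ x. e2ennreal (h x) \<partial>M)"
    by (rule nn_integral_cong_AE) (use assms in eventually_elim, simp)
  moreover have "(\<integral>\<^sup>+ x. e2ennreal (- f x) \<partial>M) = (\<integral>\<^sup>+ x. e2ennreal (- h x) \<partial>M)"
    by (rule nn_integral_cong_AE) (use assms in eventually_elim, simp)
  ultimately show ?thesis
    by (simp add: quasi_integral_def)
qed

text \<open>If \<open>y \<ge> 0\<close> the negative part vanishes; if
  \<open>- c \<le> y < 0\<close> the positive part does, and \<open>(y + c) + (- y) = c\<close>.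
  Writing this with sums only avoids truncated subtraction and keeps it true at
  \<open>y = \<infinity>\<close>.\<close>

lemma e2ennreal_add_const:
  assumes "0 \<le> c" "ereal (- c) \<le> y"
  shows "e2ennreal (y + ereal c) + e2ennreal (- y) = e2ennreal y + ennreal c"
proof (cases y)
  case (real z)
  then show ?thesis
    using assms by (cases "z \<ge> 0") (simp_all add: ennreal_neg flip: ennreal_plus)
qed (use assms in auto)

lemma nn_integral_uminus_le:
  assumes "finite_measure M" "0 \<le> c" "AE x in M. ereal (- c) \<le> f x"
  shows "(\<integral>\<^sup>+ x. e2ennreal (- f x) \<partial>M) < top"
proof -
  interpret finite_measure M by fact
  have "(\<integral>\<^sup>+ x. e2ennreal (- f x) \<partial>M) \<le> (\<integral>\<^sup>+ x. ennreal c \<partial>M)"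
    by (intro nn_integral_mono_AE, use assms(3) in eventually_elim)
      (metis e2ennreal_ereal e2ennreal_mono ereal_uminus_le_reorder uminus_ereal.simps(1))
  also have "\<dots> < top"
    by (simp add: ennreal_mult_less_top emeasure_finite less_top[symmetric] ennreal_mult_eq_top_iff)
  finally show ?thesis .
qed

text \<open>Integrate \<open>e2ennreal_add_const\<close> and cancel the negative part, whose
  integral is finite. The right-hand side contains a single nonnegative integral, to which Tonelli
  applies even if \<open>f\<close> takes the value \<open>\<infinity>\<close>.\<close>

lemma quasi_integral_bounded_below:
  assumes [measurable]: "f \<in> borel_measurable M"
    and fin: "finite_measure M" and c: "0 \<le> c" "AE x in M. ereal (- c) \<le> f x"
  shows "quasi_integral M f =
    enn2ereal (\<integral>\<^sup>+ x. e2ennreal (f x + ereal c) \<partial>M) - ereal (c * measure M (space M))"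
proof -
  interpret finite_measure M by fact
  let ?A = "\<integral>\<^sup>+ x. e2ennreal (f x) \<partial>M" and ?B = "\<integral>\<^sup>+ x. e2ennreal (- f x) \<partial>M"
  let ?C = "\<integral>\<^sup>+ x. e2ennreal (f x + ereal c) \<partial>M"
  have "?C + ?B = (\<integral>\<^sup>+ x. e2ennreal (f x + ereal c) + e2ennreal (- f x) \<partial>M)"
    by (rule nn_integral_add[symmetric]) measurable
  also have "\<dots> = (\<integral>\<^sup>+ x. e2ennreal (f x) + ennreal c \<partial>M)"
    by (rule nn_integral_cong_AE) (use c(2) in eventually_elim, simp add: e2ennreal_add_const c(1))
  also have "\<dots> = ?A + ennreal (c * measure M (space M))"
    using c(1) by (subst nn_integral_add) (auto simp: emeasure_eq_measure ennreal_mult)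
  finally have *: "?C + ?B = ?A + ennreal (c * measure M (space M))" .
  have "?B < top"
    by (rule nn_integral_uminus_le[OF fin c])
  with * show ?thesis
    unfolding quasi_integral_def using c(1)
    by (cases ?A; cases ?B; cases ?C)
      (auto simp: ennreal_minus enn2ereal_ennreal simp flip: ennreal_plus)
qed

text \<open>In \<open>ereal\<close> the difference \<open>\<infinity> - \<infinity>\<close> equals
  \<open>\<infinity>\<close>, which negation does not respect; the finite negative part of
  \<open>f\<close> rules this case out.\<close>

lemma quasi_integral_uminus:
  assumes "finite_measure M" "0 \<le> c" "AE x in M. ereal (- c) \<le> f x"
  shows "quasi_integral M (\<lambda>x. - f x) = - quasi_integral M f"
  using nn_integral_uminus_le[OF assms] unfolding quasi_integral_def
  by (cases "\<integral>\<^sup>+ x. e2ennreal (f x) \<partial>M"; cases "\<integral>\<^sup>+ x. e2ennreal (- f x) \<partial>M") auto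

text \<open>Semicontinuity makes each set \<open>{f > y}\<close> relatively open: it is the trace on
  \<open>S\<close> of the union of all open sets on whose trace \<open>f\<close> exceeds
  \<open>y\<close>.\<close>

lemma lower_semicontinuous_on_borel_measurable:
  assumes "lower_semicontinuous_on S f"
  shows "f \<in> borel_measurable (restrict_space borel S)"
proof (rule borel_measurableI_greater)
  fix y
  let ?U = "\<Union>{U. open U \<and> (\<forall>z\<in>U \<inter> S. y < f z)}"
  have "{x \<in> S. y < f x} = ?U \<inter> S"
  proof (intro equalityI subsetI)
    fix x assume x: "x \<in> {x \<in> S. y < f x}"
    then have "\<forall>\<^sub>F z in at x within S. y < f z"
      using assms by (intro less_LiminfD) (auto simp: lower_semicontinuous_on_def intro: less_le_trans)
    then obtain U where "open U" "x \<in> U" "\<And>z. z \<in> U \<Longrightarrow> z \<noteq> x \<Longrightarrow> z \<in> S \<Longrightarrow> y < f z"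
      unfolding eventually_at_topological by auto
    with x show "x \<in> ?U \<inter> S"
      by (auto intro!: exI[of _ U])
  qed auto
  moreover have "open ?U"
    by (rule open_Union) auto
  ultimately show "{x \<in> space (restrict_space borel S). y < f x} \<in> sets (restrict_space borel S)"
    by (auto simp: space_restrict_space sets_restrict_space intro!: image_eqI[of _ _ ?U])
qed

text \<open>Integrate \<open>q s * w' v\<close> over the triangle
  \<open>a \<le> s \<le> v \<le> b\<close>. Doing \<open>v\<close> first gives the integral of
  \<open>q s * (w b - w s)\<close>, doing \<open>s\<close> first that of
  \<open>w' v * (p v - p0)\<close>; equating the two is the claim. No pointwise derivative of
  \<open>p\<close> is needed.\<close>

lemma integral_by_parts_indefinite:
  fixes p q w w' :: "real \<Rightarrow> real"
  assumes ab: "a \<le> b" and q: "integrable (lebesgue_on {a..b}) q"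
    and p: "\<And>u. u \<in> {a..b} \<Longrightarrow> p u = p0 + integral {a..u} q"
    and w: "\<And>u. u \<in> {a..b} \<Longrightarrow> (w has_real_derivative w' u) (at u within {a..b})"
    and w': "continuous_on {a..b} w'"
  shows "integrable (lebesgue_on {a..b}) (\<lambda>s. w' s * p s)"
    and "integrable (lebesgue_on {a..b}) (\<lambda>s. w s * q s)"
    and "(\<integral>s. w' s * p s + w s * q s \<partial>lebesgue_on {a..b}) = w b * p b - w a * p a"
proof -
  let ?N = "lebesgue_on {a..b}"
  interpret N: finite_measure ?N
    by (rule finite_measure_lebesgue_on) simp
  interpret pair_sigma_finite ?N ?N ..
  note [measurable] = borel_measurable_integrable[OF q]
  have w'_int: "integrable ?N w'"
    by (intro integrable_continuous_real absolutely_integrable_imp_integrable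
        absolutely_integrable_continuous_real w') simp
  note [measurable] = borel_measurable_integrable[OF w'_int]
  have id_meas[measurable]: "(\<lambda>x. x) \<in> borel_measurable ?N"
    using id_borel_measurable_lebesgue_on by (simp add: id_def)
  have w_cont: "continuous_on {a..b} w"
    using w by (meson DERIV_continuous_on)
  \<comment> \<open>Bridge between Bochner integrals with a cut-off, which Fubini produces, and the
    gauge integral \<open>integral {c..d}\<close> of the forward equation.\<close>
  have restr: "integrable ?N (\<lambda>x. f x * indicator {c..d} x) \<and>
      (\<integral>x. f x * indicator {c..d} x \<partial>?N) = integral {c..d} f"
    if f: "integrable ?N f" and cd: "a \<le> c" "d \<le> b" for f :: "real \<Rightarrow> real" and c d
  proof -
    have sub: "{c..d} \<subseteq> {a..b}" using cd by auto
    have eq: "restrict_space ?N {c..d} = lebesgue_on {c..d}"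
      using sub by (subst restrict_restrict_space) (simp_all only: Int_absorb1, auto)
    have "{c..d} \<inter> space ?N \<in> sets ?N"
      using sub by (auto simp: sets_restrict_space)
    then have "integrable (lebesgue_on {c..d}) f \<longleftrightarrow> integrable ?N (\<lambda>x. f x * indicator {c..d} x)"
      "integral\<^sup>L (lebesgue_on {c..d}) f = (\<integral>x. f x * indicator {c..d} x \<partial>?N)"
      using integrable_restrict_space[of "{c..d}" ?N f] integral_restrict_space[of "{c..d}" ?N f]
      unfolding eq by (simp_all add: mult.commute)
    moreover have "integrable ?N (\<lambda>x. f x * indicator {c..d} x)"
      using integrable_mult_indicator[OF \<open>{c..d} \<inter> space ?N \<in> sets ?N\<close> f]
      unfolding space_lebesgue_on Int_absorb2[OF sub] by (simp add: mult.commute)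
    ultimately show ?thesis
      using lebesgue_integral_eq_integral[of "{c..d}" f] by simp
  qed
  have ftc: "integral {s..b} w' = w b - w s" if "s \<in> {a..b}" for s
  proof (rule integral_unique, rule fundamental_theorem_of_calculus)
    show "(w has_vector_derivative w' x) (at x within {s..b})" if "x \<in> {s..b}" for x
      using w[of x] that \<open>s \<in> {a..b}\<close>
      by (auto simp: has_real_derivative_iff_has_vector_derivative
          intro: has_vector_derivative_within_subset)
  qed (use that in auto)
  \<comment> \<open>The cut-off \<open>s \<le> v\<close> can be read as a condition on
    \<open>v\<close> for fixed \<open>s\<close> or on \<open>s\<close> for fixed \<open>v\<close>
    (\<open>f_eq\<close>); the two readings yield \<open>f_fst\<close> and
    \<open>f_snd\<close>.\<close>
  define f where "f s v = q s * w' v * indicator {s..b} v" for s v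
  have f_eq: "f s v = q s * w' v * indicator {a..v} s" if "s \<in> {a..b}" "v \<in> {a..b}" for s v
    using that by (auto simp: f_def indicator_def)
  have f_fst: "(\<integral>v. f s v \<partial>?N) = q s * (w b - w s)"
      "integrable ?N (f s)" if "s \<in> {a..b}" for s
    using restr[OF w'_int, of s b] ftc[OF that] that
    by (simp_all add: f_def[abs_def] mult.assoc)
  have f_snd: "(\<integral>s. f s v \<partial>?N) = w' v * (p v - p0)" if "v \<in> {a..b}" for v
  proof -
    have "(\<integral>s. f s v \<partial>?N) = (\<integral>s. w' v * (q s * indicator {a..v} s) \<partial>?N)"
      using that by (intro Bochner_Integration.integral_cong) (auto simp: f_eq)
    then show ?thesis
      using restr[OF q, of a v] p[OF that] that by simp
  qed
  have f_meas: "case_prod f \<in> borel_measurable (?N \<Otimes>\<^sub>M ?N)"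
  proof -
    have "(\<lambda>x. q (fst x) * w' (snd x) * (if fst x \<le> snd x then 1 else 0))
        \<in> borel_measurable (?N \<Otimes>\<^sub>M ?N)"
      by measurable
    then show ?thesis
      by (rule measurable_cong[THEN iffD1, rotated])
        (auto simp: f_def space_pair_measure indicator_def)
  qed
  \<comment> \<open>On the full square the integrand is a product of two integrable functions; it
    dominates \<open>f\<close>.\<close>
  have "integrable (?N \<Otimes>\<^sub>M ?N) (\<lambda>x. q (fst x) * w' (snd x))"
    by (rule Fubini_integrable) (use q w'_int in \<open>auto simp: abs_mult\<close>)
  then have "integrable (?N \<Otimes>\<^sub>M ?N) (case_prod f)"
    by (rule Bochner_Integration.integrable_bound[OF _ f_meas])
      (auto simp: f_def indicator_def abs_mult)
  note Fubini_integral[OF this]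
  moreover have "(\<integral>v. \<integral>s. f s v \<partial>?N \<partial>?N) = (\<integral>v. w' v * (p v - p0) \<partial>?N)"
    by (rule Bochner_Integration.integral_cong) (simp_all add: f_snd)
  moreover have "(\<integral>s. \<integral>v. f s v \<partial>?N \<partial>?N) = (\<integral>s. q s * (w b - w s) \<partial>?N)"
    by (rule Bochner_Integration.integral_cong) (simp_all add: f_fst(1))
  ultimately have fub: "(\<integral>v. w' v * (p v - p0) \<partial>?N) = (\<integral>s. q s * (w b - w s) \<partial>?N)"
    by simp
  have p_cont: "continuous_on {a..b} p"
  proof -
    have "continuous_on {a..b} (\<lambda>u. p0 + integral {a..u} q)"
      by (intro continuous_intros indefinite_integral_continuous_1 integrable_on_lebesgue_on q) simp
    then show ?thesis
      by (subst continuous_on_cong[OF refl p]) auto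
  qed
  show int1: "integrable ?N (\<lambda>s. w' s * p s)"
    by (intro integrable_continuous_real absolutely_integrable_imp_integrable
        absolutely_integrable_continuous_real continuous_intros w' p_cont) simp
  have "(\<lambda>s. w s * q s) absolutely_integrable_on {a..b}"
    using q by (intro absolutely_integrable_bounded_measurable_product_real
        continuous_imp_measurable_on_sets_lebesgue w_cont compact_imp_bounded
        compact_continuous_image) (auto simp: set_integrable_def integrable_restrict_space)
  then show int2: "integrable ?N (\<lambda>s. w s * q s)"
    by (rule absolutely_integrable_imp_integrable) simp
  have w'_eq: "integral\<^sup>L ?N w' = w b - w a"
    using lebesgue_integral_eq_integral[OF w'_int] ftc[of a] ab by simp
  have q_eq: "integral\<^sup>L ?N q = p b - p0"
    using lebesgue_integral_eq_integral[OF q] p[of b] ab by simp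
  have "(\<integral>v. w' v * (p v - p0) \<partial>?N) = (\<integral>v. w' v * p v \<partial>?N) - (w b - w a) * p0"
    using int1 w'_int w'_eq by (simp add: right_diff_distrib)
  moreover have "(\<integral>s. q s * (w b - w s) \<partial>?N) = (p b - p0) * w b - (\<integral>s. w s * q s \<partial>?N)"
    using int2 q q_eq by (simp add: right_diff_distrib left_diff_distrib mult.commute[of "q _" "w _"] mult.commute[of _ "w b"])
  moreover have "p a = p0"
    using p[of a] ab by simp
  ultimately show "(\<integral>s. w' s * p s + w s * q s \<partial>?N) = w b * p b - w a * p a"
    using int1 int2 fub by (simp add: algebra_simps)
qed

subsection \<open>The payoff in terms of the marginals of the chain\<close>

lemma markov_chain_on_measurable:
  assumes "usual_filtration M F" "markov_chain_on M F \<V> t T i lam X" "s \<in> {t..T}"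
  shows "X s \<in> M \<rightarrow>\<^sub>M count_space UNIV"
proof -
  have "X s \<in> F s \<rightarrow>\<^sub>M count_space UNIV" "subalgebra M (F s)"
    using assms by (auto simp: markov_chain_on_def usual_filtration_def)
  then show ?thesis
    by (rule measurable_from_subalg[rotated])
qed

text \<open>Apply the Markov property at the initial time \<open>t\<close> and take expectations:
  the conditional probability is almost surely the constant \<open>P t u i j\<close>, since the
  chain starts at \<open>i\<close>.\<close>

lemma markov_chain_on_marginals:
  fixes \<V> :: "'i::finite \<Rightarrow> 'i set"
  assumes "prob_space M" and filt: "usual_filtration M F"
    and chain: "markov_chain_on M F \<V> t T i lam X"
  shows "\<exists>P. transition_function \<V> t T lam P \<and>
    (\<forall>u\<in>{t..T}. \<forall>j. measure M {\<omega> \<in> space M. X u \<omega> = j} = P t u i j)"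
proof -
  interpret prob_space M by fact
  obtain P where P: "transition_function \<V> t T lam P"
    and markov: "\<And>s u j. t \<le> s \<Longrightarrow> s \<le> u \<Longrightarrow> u \<le> T \<Longrightarrow>
      AE \<omega> in M. real_cond_exp M (F s) (indicat_real {\<omega>' \<in> space M. X u \<omega>' = j}) \<omega>
        = P s u (X s \<omega>) j"
    and init: "AE \<omega> in M. X t \<omega> = i"
    using chain by (auto simp: markov_chain_on_def)
  have "measure M {\<omega> \<in> space M. X u \<omega> = j} = P t u i j" if u: "u \<in> {t..T}" for u j
  proof -
    let ?E = "{\<omega> \<in> space M. X u \<omega> = j}"
    have [measurable]: "X u \<in> M \<rightarrow>\<^sub>M count_space UNIV"
      using markov_chain_on_measurable[OF filt chain u] .
    interpret finite_measure_subalgebra M "F t"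
      by standard (use filt in \<open>auto simp: usual_filtration_def\<close>)
    have "measure M ?E = (\<integral>\<omega>. indicat_real ?E \<omega> \<partial>M)"
      by simp
    also have "\<dots> = (\<integral>\<omega>. real_cond_exp M (F t) (indicat_real ?E) \<omega> \<partial>M)"
      by (rule real_cond_exp_int(2)[symmetric]) (simp add: integrable_indicator_iff emeasure_finite less_top[symmetric])
    also have "\<dots> = (\<integral>\<omega>. P t u i j \<partial>M)"
    proof (rule integral_cong_AE)
      show "AE \<omega> in M. real_cond_exp M (F t) (indicat_real ?E) \<omega> = P t u i j"
        using markov[of t u j] init u by auto
    qed auto
    finally show ?thesis
      by (simp add: prob_space)
  qed
  with P show ?thesis
    by blast
qed

text \<open>
  Evaluating a right-continuous process at grid points approaching the current time from the right
  shows that the process is jointly measurable.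
\<close>

lemma cadlag_discrete_jointly_measurable:
  fixes X :: "real \<Rightarrow> 'w \<Rightarrow> 'i"
  assumes tT: "t \<le> T" and X: "\<And>s. s \<in> {t..T} \<Longrightarrow> X s \<in> M \<rightarrow>\<^sub>M count_space UNIV"
  shows "\<exists>A. (\<forall>j. A j \<in> sets (borel \<Otimes>\<^sub>M M)) \<and>
    (\<forall>\<omega>\<in>space M. cadlag_discrete_on t T (\<lambda>s. X s \<omega>) \<longrightarrow>
      (\<forall>s\<in>{t..T}. \<forall>j. (s, \<omega>) \<in> A j \<longleftrightarrow> X s \<omega> = j))"
proof -
  \<comment> \<open>Clamping to \<open>{t..T}\<close> is essential, as \<open>X\<close> is
    measurable at those times only. \<open>d n s\<close> rounds \<open>s\<close> up to the grid of
    mesh \<open>1 / Suc n\<close>, from the side where paths are continuous.\<close>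
  define grid :: "nat \<Rightarrow> int \<Rightarrow> real" where "grid n m = max t (min T (t + m / Suc n))" for n m
  define d where "d n s = grid n \<lceil>(s - t) * Suc n\<rceil>" for n s
  \<comment> \<open>Defined by eventual constancy, \<open>A j\<close> is measurable without any
    assumption on the paths; it agrees with the event \<open>X s = j\<close> on cadlag paths
    only.\<close>
  define A where "A j = {x \<in> space (borel \<Otimes>\<^sub>M M). \<exists>N. \<forall>n\<ge>N. X (d n (fst x)) (snd x) = j}" for j
  have grid: "grid n m \<in> {t..T}" for n m
    using tT by (auto simp: grid_def)
  \<comment> \<open>For fixed \<open>n\<close> the evaluation time takes countably many values,
    indexed by the integer ceiling.\<close>
  have [measurable]: "(\<lambda>x. X (d n (fst x)) (snd x)) \<in> borel \<Otimes>\<^sub>M M \<rightarrow>\<^sub>M count_space UNIV" for n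
    unfolding d_def
  proof (rule measurable_compose_countable)
    show "(\<lambda>x. X (grid n m) (snd x)) \<in> borel \<Otimes>\<^sub>M M \<rightarrow>\<^sub>M count_space UNIV" for m
      by (rule measurable_compose[OF measurable_snd X[OF grid]])
  qed measurable
  have "A j \<in> sets (borel \<Otimes>\<^sub>M M)" for j
    unfolding A_def by measurable
  moreover have "(s, \<omega>) \<in> A j \<longleftrightarrow> X s \<omega> = j"
    if \<omega>: "\<omega> \<in> space M" "cadlag_discrete_on t T (\<lambda>s. X s \<omega>)" and s: "s \<in> {t..T}" for j s \<omega>
  proof -
    have bounds: "s \<le> t + \<lceil>(s - t) * Suc n\<rceil> / Suc n" "t + \<lceil>(s - t) * Suc n\<rceil> / Suc n < s + 1 / Suc n" for n
    proof -
      have "x \<le> \<lceil>x * k\<rceil> / k" "\<lceil>x * k\<rceil> / k < x + 1 / k" if "k > 0" for x k :: real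
      proof -
        have "x * k \<le> \<lceil>x * k\<rceil>" "\<lceil>x * k\<rceil> < (x + 1 / k) * k"
          using that by (simp_all add: distrib_right) linarith+
        then show "x \<le> \<lceil>x * k\<rceil> / k" "\<lceil>x * k\<rceil> / k < x + 1 / k"
          using that by (simp_all add: pos_le_divide_eq pos_divide_less_eq)
      qed
      from this[of "real (Suc n)" "s - t"]
      show "s \<le> t + \<lceil>(s - t) * Suc n\<rceil> / Suc n" "t + \<lceil>(s - t) * Suc n\<rceil> / Suc n < s + 1 / Suc n"
        by linarith+
    qed
    have d: "s \<le> d n s" "d n s < s + 1 / Suc n" "d n s \<le> T" for n
      using bounds[of n] s unfolding d_def grid_def by auto
    \<comment> \<open>At \<open>T\<close> there is no right-continuity to use, but there the
      clamping forces \<open>d n T = T\<close>.\<close>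
    have "\<exists>N. \<forall>n\<ge>N. X (d n s) \<omega> = X s \<omega>"
    proof (cases "s = T")
      case True
      then have "d n s = s" for n
        using d[of n] by simp
      then show ?thesis by simp
    next
      case False
      then have "\<forall>\<^sub>F u in at_right s. X u \<omega> = X s \<omega>"
        using \<omega>(2) s by (simp add: cadlag_discrete_on_def)
      then obtain b where b: "b > s" "\<And>u. s < u \<Longrightarrow> u < b \<Longrightarrow> X u \<omega> = X s \<omega>"
        unfolding eventually_at_right_field by auto
      obtain N where N: "1 / Suc N < b - s"
        using b(1) reals_Archimedean[of "b - s"] by (auto simp: inverse_eq_divide)
      have "X (d n s) \<omega> = X s \<omega>" if "n \<ge> N" for n
      proof -
        have "1 / Suc n \<le> 1 / Suc N"
          using that by (simp add: field_simps)
        then have "d n s < b"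
          using d(2)[of n] N by linarith
        then show ?thesis
          using b(2)[of "d n s"] d(1)[of n] by (cases "d n s = s") auto
      qed
      then show ?thesis by blast
    qed
    then obtain N where "\<And>n. n \<ge> N \<Longrightarrow> X (d n s) \<omega> = X s \<omega>"
      by blast
    then show ?thesis
      using \<omega>(1) unfolding A_def by (auto simp: space_pair_measure) (metis nat_le_linear)
  qed
  ultimately show ?thesis
    by blast
qed

text \<open>Both the running and the terminal term are sums over nodes weighted by indicators of
  \<open>X s = j\<close>; Tonelli replaces the indicators by their probabilities. The bound
  \<open>- c \<le> h\<close> makes the shifted integrand nonnegative, so infinite costs are
  harmless.\<close>

lemma expected_payoff_marginals:
  fixes X :: "real \<Rightarrow> 'w \<Rightarrow> 'i::finite" and h :: "real \<Rightarrow> 'i \<Rightarrow> ereal" and G :: "'i \<Rightarrow> real"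
  assumes "prob_space M" and tT: "t \<le> T"
    and X: "\<And>s. s \<in> {t..T} \<Longrightarrow> X s \<in> M \<rightarrow>\<^sub>M count_space UNIV"
    and cadlag: "AE \<omega> in M. cadlag_discrete_on t T (\<lambda>s. X s \<omega>)"
    and h[measurable]: "\<And>j. (\<lambda>s. h s j) \<in> borel_measurable (lebesgue_on {t..T})"
    and c: "0 \<le> c" "\<And>s j. s \<in> {t..T} \<Longrightarrow> ereal (- c) \<le> h s j"
  shows "quasi_integral M (\<lambda>\<omega>. - quasi_integral (lebesgue_on {t..T}) (\<lambda>s. h s (X s \<omega>)) + ereal (G (X T \<omega>)))
    = ereal ((\<Sum>j\<in>UNIV. measure M {\<omega> \<in> space M. X T \<omega> = j} * G j) + c * (T - t))
      - enn2ereal (\<integral>\<^sup>+ s. (\<Sum>j\<in>UNIV. ennreal (measure M {\<omega> \<in> space M. X s \<omega> = j}) * e2ennreal (h s j + ereal c))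
          \<partial>lebesgue_on {t..T})"
proof -
  let ?N = "lebesgue_on {t..T}"
  interpret prob_space M by fact
  interpret N: finite_measure ?N
    by (rule finite_measure_lebesgue_on) simp
  interpret NM: pair_sigma_finite ?N M ..
  have N_space: "measure ?N {t..T} = T - t"
    using tT by (simp add: measure_restrict_space)
  have [measurable]: "(\<lambda>x. x) \<in> ?N \<rightarrow>\<^sub>M borel"
    using id_borel_measurable_lebesgue_on by (simp add: id_def)
  have "\<exists>A. (\<forall>j. A j \<in> sets (borel \<Otimes>\<^sub>M M)) \<and>
    (\<forall>\<omega>\<in>space M. cadlag_discrete_on t T (\<lambda>s. X s \<omega>) \<longrightarrow>
      (\<forall>s\<in>{t..T}. \<forall>j. (s, \<omega>) \<in> A j \<longleftrightarrow> X s \<omega> = j))"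
    using tT X by (rule cadlag_discrete_jointly_measurable)
  then obtain A where A0: "\<forall>j. A j \<in> sets (borel \<Otimes>\<^sub>M M)"
      "\<forall>\<omega>\<in>space M. cadlag_discrete_on t T (\<lambda>s. X s \<omega>) \<longrightarrow>
        (\<forall>s\<in>{t..T}. \<forall>j. (s, \<omega>) \<in> A j \<longleftrightarrow> X s \<omega> = j)"
    by (elim exE conjE)
  have A[measurable]: "A j \<in> sets (borel \<Otimes>\<^sub>M M)" for j
    using A0(1) by blast
  have A_iff: "(s, \<omega>) \<in> A j \<longleftrightarrow> X s \<omega> = j"
    if "\<omega> \<in> space M" "cadlag_discrete_on t T (\<lambda>s. X s \<omega>)" "s \<in> {t..T}" for j s \<omega>
    using A0(2) that by blast
  define \<phi> where "\<phi> s j = e2ennreal (h s j + ereal c)" for s j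
  \<comment> \<open>The sets \<open>A j\<close> stand in for the events \<open>X s = j\<close> to
    give joint measurability in \<open>(s, \<omega>)\<close>.\<close>
  define f where "f s \<omega> = (\<Sum>j\<in>UNIV. \<phi> s j * indicator (A j) (s, \<omega>))" for s \<omega>
  define W where "W \<omega> = (\<integral>\<^sup>+ s. f s \<omega> \<partial>?N)" for \<omega>
  define b where "b = (\<Sum>j\<in>UNIV. \<bar>G j\<bar>)"
  \<comment> \<open>\<open>Q\<close> is the negated payoff on cadlag paths. The negation is what is
    bounded below, by \<open>- (c * (T - t) + b)\<close>, so that
    \<open>quasi_integral_bounded_below\<close> applies to it.\<close>
  define Q where "Q \<omega> = enn2ereal (W \<omega>) - ereal (c * (T - t)) + ereal (- G (X T \<omega>))" for \<omega>
  have [measurable]: "(\<lambda>s. \<phi> s j) \<in> borel_measurable ?N" for j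
    unfolding \<phi>_def by measurable
  have [measurable]: "(\<lambda>x. indicator (A j) (fst x, snd x) :: ennreal) \<in> borel_measurable (?N \<Otimes>\<^sub>M M)" for j
  proof -
    have "(\<lambda>x. (fst x, snd x)) \<in> ?N \<Otimes>\<^sub>M M \<rightarrow>\<^sub>M borel \<Otimes>\<^sub>M M"
      by (rule measurable_Pair) (auto intro: measurable_compose[OF measurable_fst])
    from measurable_compose[OF this borel_measurable_indicator[OF A]] show ?thesis .
  qed
  have f_meas[measurable]: "(\<lambda>x. f (fst x) (snd x)) \<in> borel_measurable (?N \<Otimes>\<^sub>M M)"
    unfolding f_def by measurable
  have W_meas[measurable]: "W \<in> borel_measurable M"
    unfolding W_def[abs_def]
    by (rule N.borel_measurable_nn_integral) (use f_meas in \<open>simp add: measurable_pair_swap_iff[of _ M] split_beta'\<close>)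
  have XT[measurable]: "X T \<in> M \<rightarrow>\<^sub>M count_space UNIV"
    using X tT by simp
  have [measurable]: "(\<lambda>\<omega>. G (X T \<omega>)) \<in> borel_measurable M"
    by (rule measurable_compose[OF XT]) simp
  have [measurable]: "Q \<in> borel_measurable M"
    unfolding Q_def[abs_def] by measurable
  have G_le: "\<bar>G j\<bar> \<le> b" for j
    unfolding b_def by (rule member_le_sum) auto
  have b: "0 \<le> b"
    unfolding b_def by (simp add: sum_nonneg)
  have Q_ge: "AE \<omega> in M. ereal (- (c * (T - t) + b)) \<le> Q \<omega>"
  proof (rule AE_I2)
    fix \<omega> show "ereal (- (c * (T - t) + b)) \<le> Q \<omega>"
      using G_le[of "X T \<omega>"] unfolding Q_def by (cases "W \<omega>") (auto simp: enn2ereal_ennreal)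
  qed
  have "AE \<omega> in M. - quasi_integral ?N (\<lambda>s. h s (X s \<omega>)) + ereal (G (X T \<omega>)) = - Q \<omega>"
    using cadlag AE_space
  proof eventually_elim
    case (elim \<omega>)
    have eq: "(s, \<omega>) \<in> A j \<longleftrightarrow> X s \<omega> = j" if "s \<in> {t..T}" for s j
      using A_iff elim that by blast
    have "(\<lambda>s. X s \<omega>) \<in> ?N \<rightarrow>\<^sub>M count_space UNIV"
    proof (subst measurable_count_space_eq2_countable, safe)
      fix j
      have "(\<lambda>s. X s \<omega>) -` {j} \<inter> space ?N = {s \<in> space ?N. (s, \<omega>) \<in> A j}"
        using eq by auto
      also have "\<dots> \<in> sets ?N"
        using elim(2) by measurable
      finally show "(\<lambda>s. X s \<omega>) -` {j} \<inter> space ?N \<in> sets ?N" .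
    qed auto
    with h have "(\<lambda>s. h s (X s \<omega>)) \<in> borel_measurable ?N"
      by (rule measurable_compose_countable)
    then have "quasi_integral ?N (\<lambda>s. h s (X s \<omega>)) =
        enn2ereal (\<integral>\<^sup>+ s. e2ennreal (h s (X s \<omega>) + ereal c) \<partial>?N) - ereal (c * (T - t))"
      using c by (subst quasi_integral_bounded_below[OF _ N.finite_measure_axioms])
        (auto simp: N_space)
    also have "(\<integral>\<^sup>+ s. e2ennreal (h s (X s \<omega>) + ereal c) \<partial>?N) = W \<omega>"
      unfolding W_def
    proof (rule nn_integral_cong)
      fix s assume "s \<in> space ?N"
      then have "f s \<omega> = (\<Sum>j\<in>UNIV. if j = X s \<omega> then \<phi> s j else 0)"
        unfolding f_def by (intro sum.cong) (auto simp: eq indicator_def)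
      then show "e2ennreal (h s (X s \<omega>) + ereal c) = f s \<omega>"
        by (simp add: \<phi>_def)
    qed
    finally show ?case
      unfolding Q_def by (cases "W \<omega>") (auto simp: enn2ereal_ennreal)
  qed
  then have "quasi_integral M (\<lambda>\<omega>. - quasi_integral ?N (\<lambda>s. h s (X s \<omega>)) + ereal (G (X T \<omega>)))
      = quasi_integral M (\<lambda>\<omega>. - Q \<omega>)"
    by (rule quasi_integral_cong_AE)
  also have "\<dots> = - quasi_integral M Q"
  by (rule quasi_integral_uminus[OF finite_measure_axioms _ Q_ge]) (use b c tT in simp)
  also have "quasi_integral M Q =
      enn2ereal (\<integral>\<^sup>+ \<omega>. e2ennreal (Q \<omega> + ereal (c * (T - t) + b)) \<partial>M) - ereal (c * (T - t) + b)"
    by (subst quasi_integral_bounded_below[OF _ finite_measure_axioms _ Q_ge])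
      (use b c tT in \<open>simp_all add: prob_space\<close>)
  \<comment> \<open>The shift cancels \<open>c * (T - t)\<close> and turns the terminal term into
    \<open>b - G\<close>, which is nonnegative by the choice of \<open>b\<close>.\<close>
  also have "(\<integral>\<^sup>+ \<omega>. e2ennreal (Q \<omega> + ereal (c * (T - t) + b)) \<partial>M)
      = (\<integral>\<^sup>+ \<omega>. W \<omega> + ennreal (b - G (X T \<omega>)) \<partial>M)"
  proof (rule nn_integral_cong)
    fix \<omega> show "e2ennreal (Q \<omega> + ereal (c * (T - t) + b)) = W \<omega> + ennreal (b - G (X T \<omega>))"
      using G_le[of "X T \<omega>"] unfolding Q_def
      by (cases "W \<omega>") (auto simp: enn2ereal_ennreal simp flip: ennreal_plus)
  qed
  also have "\<dots> = (\<integral>\<^sup>+ \<omega>. W \<omega> \<partial>M) + (\<integral>\<^sup>+ \<omega>. ennreal (b - G (X T \<omega>)) \<partial>M)"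
    by (rule nn_integral_add) measurable
  also have "(\<integral>\<^sup>+ \<omega>. ennreal (b - G (X T \<omega>)) \<partial>M) =
      ennreal (b - (\<Sum>j\<in>UNIV. measure M {\<omega> \<in> space M. X T \<omega> = j} * G j))"
  proof -
    have int: "integrable M (\<lambda>\<omega>. G (X T \<omega>))"
      by (rule integrable_const_bound[where B = b]) (use G_le in auto)
    have "(\<integral>\<omega>. G (X T \<omega>) \<partial>M) = (\<integral>\<omega>. (\<Sum>j\<in>UNIV. indicat_real {\<omega> \<in> space M. X T \<omega> = j} \<omega> * G j) \<partial>M)"
    proof (rule Bochner_Integration.integral_cong)
      fix \<omega> assume "\<omega> \<in> space M"
      then have "(\<Sum>j\<in>UNIV. indicat_real {\<omega> \<in> space M. X T \<omega> = j} \<omega> * G j) =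
          (\<Sum>j\<in>UNIV. if j = X T \<omega> then G j else 0)"
        by (intro sum.cong) auto
      then show "G (X T \<omega>) = (\<Sum>j\<in>UNIV. indicat_real {\<omega> \<in> space M. X T \<omega> = j} \<omega> * G j)"
        by simp
    qed simp
    also have "\<dots> = (\<Sum>j\<in>UNIV. measure M {\<omega> \<in> space M. X T \<omega> = j} * G j)"
      by (subst Bochner_Integration.integral_sum)
        (auto simp: integrable_indicator_iff emeasure_finite less_top[symmetric] intro!: integrable_mult_left)
    finally show ?thesis
      using int G_le by (subst nn_integral_eq_integral) (auto simp: prob_space abs_le_iff)
  qed
  also have "(\<integral>\<^sup>+ \<omega>. W \<omega> \<partial>M) = (\<integral>\<^sup>+ s. (\<Sum>j\<in>UNIV. ennreal (measure M {\<omega> \<in> space M. X s \<omega> = j}) * \<phi> s j) \<partial>?N)"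
  proof -
    have "(\<integral>\<^sup>+ \<omega>. W \<omega> \<partial>M) = (\<integral>\<^sup>+ s. (\<integral>\<^sup>+ \<omega>. f s \<omega> \<partial>M) \<partial>?N)"
      unfolding W_def by (rule NM.Fubini') (use f_meas in \<open>simp add: split_beta'\<close>)
    also have "\<dots> = (\<integral>\<^sup>+ s. (\<Sum>j\<in>UNIV. ennreal (measure M {\<omega> \<in> space M. X s \<omega> = j}) * \<phi> s j) \<partial>?N)"
    proof (rule nn_integral_cong)
      fix s assume "s \<in> space ?N"
      then have s: "s \<in> {t..T}" by simp
      note [measurable] = X[OF s]
      \<comment> \<open>At a fixed time \<open>s\<close>, \<open>A j\<close> may be replaced by the
        genuine event, the two differing on a null set of paths.\<close>
      have "(\<integral>\<^sup>+ \<omega>. f s \<omega> \<partial>M) = (\<integral>\<^sup>+ \<omega>. (\<Sum>j\<in>UNIV. \<phi> s j * indicator {\<omega> \<in> space M. X s \<omega> = j} \<omega>) \<partial>M)"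
        unfolding f_def
        by (rule nn_integral_cong_AE, use cadlag AE_space in eventually_elim)
          (auto intro!: sum.cong simp: indicator_def A_iff[OF _ _ s])
      also have "\<dots> = (\<Sum>j\<in>UNIV. ennreal (measure M {\<omega> \<in> space M. X s \<omega> = j}) * \<phi> s j)"
        by (subst nn_integral_sum) (auto simp: nn_integral_cmult emeasure_eq_measure mult.commute)
      finally show "(\<integral>\<^sup>+ \<omega>. f s \<omega> \<partial>M) = (\<Sum>j\<in>UNIV. ennreal (measure M {\<omega> \<in> space M. X s \<omega> = j}) * \<phi> s j)" .
    qed
    finally show ?thesis .
  qed
  finally have main: "quasi_integral M (\<lambda>\<omega>. - quasi_integral ?N (\<lambda>s. h s (X s \<omega>)) + ereal (G (X T \<omega>))) =
    - (enn2ereal ((\<integral>\<^sup>+ s. (\<Sum>j\<in>UNIV. ennreal (measure M {\<omega> \<in> space M. X s \<omega> = j}) * \<phi> s j) \<partial>?N) +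
      ennreal (b - (\<Sum>j\<in>UNIV. measure M {\<omega> \<in> space M. X T \<omega> = j} * G j))) - ereal (c * (T - t) + b))" .
  have "(\<Sum>j\<in>UNIV. measure M {\<omega> \<in> space M. X T \<omega> = j} * G j) \<le> b"
    unfolding b_def
  proof (rule sum_mono)
    fix j
    have "measure M {\<omega> \<in> space M. X T \<omega> = j} * G j \<le> measure M {\<omega> \<in> space M. X T \<omega> = j} * \<bar>G j\<bar>"
      by (intro mult_left_mono) auto
    also have "\<dots> \<le> 1 * \<bar>G j\<bar>"
      by (intro mult_right_mono) auto
    finally show "measure M {\<omega> \<in> space M. X T \<omega> = j} * G j \<le> \<bar>G j\<bar>" by simp
  qed
  then show ?thesis
    unfolding main \<phi>_def
    by (cases "\<integral>\<^sup>+ s. (\<Sum>j\<in>UNIV. ennreal (measure M {\<omega> \<in> space M. X s \<omega> = j}) * e2ennreal (h s j + ereal c)) \<partial>?N")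
      (auto simp: enn2ereal_ennreal simp flip: ennreal_plus)
qed

subsection \<open>Verification\<close>

text \<open>This is the generator of the chain acting on \<open>y\<close>. Its rows sum to zero, so
  only increments remain; a loop at \<open>k\<close> would be charged on the diagonal without its
  compensating gain.\<close>

lemma rate_matrix_row_sum:
  fixes \<V> :: "'i::finite \<Rightarrow> 'i set" and y :: "'i \<Rightarrow> real"
  assumes "k \<notin> \<V> k"
  shows "(\<Sum>j\<in>UNIV. y j * rate_matrix \<V> lam s k j) = (\<Sum>j\<in>\<V> k. lam s k j * (y j - y k))"
proof -
  have "(\<Sum>j\<in>UNIV. y j * rate_matrix \<V> lam s k j) =
      (\<Sum>j\<in>UNIV. (if j = k then - (y k * (\<Sum>l\<in>\<V> k. lam s k l)) else 0) +
        (if j \<in> \<V> k then lam s k j * y j else 0))"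
    by (rule sum.cong) (use assms in \<open>auto simp: rate_matrix_def\<close>)
  also have "\<dots> = - (y k * (\<Sum>l\<in>\<V> k. lam s k l)) + (\<Sum>j\<in>\<V> k. lam s k j * y j)"
    by (simp add: sum.distrib sum.If_cases)
  finally show ?thesis
    by (simp add: right_diff_distrib sum_subtractf sum_distrib_left mult.commute)
qed

text \<open>Dynkin's formula for a time-dependent function: \<open>D\<close> is the mean of the time
  derivative plus the generator of \<open>W\<close>. Each marginal is the indefinite integral of
  \<open>q j\<close>, so integrate by parts node by node; exchanging the sums over \<open>j\<close>
  and \<open>k\<close> moves the rate matrix from the marginals onto \<open>W\<close>.\<close>

lemma transition_function_dynkin:
  fixes \<V> :: "'i::finite \<Rightarrow> 'i set" and W :: "'i \<Rightarrow> real \<Rightarrow> real" and i :: 'i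
  assumes irrefl: "\<And>k. k \<notin> \<V> k" and tT: "t \<le> T"
    and P: "transition_function \<V> t T lam P"
    and W: "\<And>j s. s \<in> {t..T} \<Longrightarrow> (W j has_real_derivative W' j s) (at s within {t..T})"
    and W': "\<And>j. continuous_on {t..T} (W' j)"
  defines "D \<equiv> \<lambda>s. \<Sum>k\<in>UNIV. P t s i k * (W' k s + (\<Sum>j\<in>\<V> k. lam s k j * (W j s - W k s)))"
  shows "integrable (lebesgue_on {t..T}) D"
    and "integral\<^sup>L (lebesgue_on {t..T}) D = (\<Sum>j\<in>UNIV. P t T i j * W j T) - W i t"
proof -
  let ?N = "lebesgue_on {t..T}"
  define q where "q j s = (\<Sum>k\<in>UNIV. P t s i k * rate_matrix \<V> lam s k j)" for j s
  have q: "integrable ?N (q j)" for j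
    using P tT unfolding transition_function_def q_def[abs_def]
    by (intro absolutely_integrable_imp_integrable) auto
  have p: "P t u i j = of_bool (i = j) + integral {t..u} (q j)" if "u \<in> {t..T}" for u j
    using P that unfolding transition_function_def q_def[abs_def] by auto
  have P0: "P t t i j = of_bool (i = j)" for j
    using p[of t j] tT by simp
  have ibp: "integrable ?N (\<lambda>s. W' j s * P t s i j + W j s * q j s)"
    "(\<integral>s. W' j s * P t s i j + W j s * q j s \<partial>?N) = W j T * P t T i j - W j t * of_bool (i = j)" for j
    using integral_by_parts_indefinite[where p = "\<lambda>u. P t u i j", OF tT q p[of _ j] W[of _ j] W'[of j]]
    by (auto simp: P0)
  have D_eq: "D s = (\<Sum>j\<in>UNIV. W' j s * P t s i j + W j s * q j s)" for s
  proof -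
    have "(\<Sum>j\<in>UNIV. W j s * q j s) = (\<Sum>k\<in>UNIV. \<Sum>j\<in>UNIV. P t s i k * (W j s * rate_matrix \<V> lam s k j))"
      unfolding q_def sum_distrib_left by (subst sum.swap) (simp add: mult_ac)
    also have "\<dots> = (\<Sum>k\<in>UNIV. P t s i k * (\<Sum>j\<in>\<V> k. lam s k j * (W j s - W k s)))"
      by (simp add: rate_matrix_row_sum[OF irrefl] flip: sum_distrib_left)
    finally show ?thesis
      by (simp add: D_def distrib_left sum.distrib mult.commute)
  qed
  show "integrable ?N D"
    unfolding D_eq[abs_def] using ibp(1) by simp
  have "integral\<^sup>L ?N D = (\<Sum>j\<in>UNIV. W j T * P t T i j - W j t * of_bool (i = j))"
    unfolding D_eq[abs_def] by (subst Bochner_Integration.integral_sum) (use ibp in simp_all)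
  also have "\<dots> = (\<Sum>j\<in>UNIV. P t T i j * W j T) - W i t"
    by (simp add: sum_subtractf mult.commute[of "W _ T"])
  finally show "integral\<^sup>L ?N D = (\<Sum>j\<in>UNIV. P t T i j * W j T) - W i t" .
qed

text \<open>Here \<open>d + c\<close> may be negative, so real integrals are first raised to
  integrals of positive parts. Only the weighted sum is assumed integrable, hence sums are compared
  pointwise and never split under the integral.\<close>

lemma running_cost_lower_bound:
  fixes p d :: "'i::finite \<Rightarrow> 'a \<Rightarrow> real" and h :: "'i \<Rightarrow> 'a \<Rightarrow> ereal"
  assumes "finite_measure M" and int: "integrable M (\<lambda>s. \<Sum>k\<in>UNIV. p k s * d k s)"
    and p: "\<And>k s. s \<in> space M \<Longrightarrow> 0 \<le> p k s" "\<And>s. s \<in> space M \<Longrightarrow> (\<Sum>k\<in>UNIV. p k s) = 1"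
    and le: "\<And>k s. s \<in> space M \<Longrightarrow> ereal (d k s) \<le> h k s"
  shows "ereal ((\<integral>s. (\<Sum>k\<in>UNIV. p k s * d k s) \<partial>M) + c * measure M (space M))
    \<le> enn2ereal (\<integral>\<^sup>+ s. (\<Sum>k\<in>UNIV. ennreal (p k s) * e2ennreal (h k s + ereal c)) \<partial>M)"
proof -
  interpret finite_measure M by fact
  let ?D = "\<lambda>s. (\<Sum>k\<in>UNIV. p k s * d k s) + c"
  have int': "integrable M ?D"
    using int by simp
  have "ennreal (integral\<^sup>L M ?D) \<le> (\<integral>\<^sup>+ s. ennreal (?D s) \<partial>M)"
  proof -
    have "integral\<^sup>L M ?D \<le> (\<integral>s. max 0 (?D s) \<partial>M)"
      by (rule integral_mono) (use int' in auto)
    also have "ennreal \<dots> = (\<integral>\<^sup>+ s. ennreal (max 0 (?D s)) \<partial>M)"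
      by (rule nn_integral_eq_integral[symmetric]) (use int' in auto)
    finally show ?thesis
      by (simp add: ennreal_leI max.commute[of 0])
  qed
  also have "\<dots> \<le> (\<integral>\<^sup>+ s. (\<Sum>k\<in>UNIV. ennreal (p k s) * e2ennreal (h k s + ereal c)) \<partial>M)"
  proof (rule nn_integral_mono)
    fix s assume s: "s \<in> space M"
    have "?D s = (\<Sum>k\<in>UNIV. p k s * (d k s + c))"
      using p(2)[OF s] by (simp add: distrib_left sum.distrib flip: sum_distrib_right)
    also have "ennreal \<dots> \<le> (\<Sum>k\<in>UNIV. ennreal (p k s * max 0 (d k s + c)))"
      using p(1)[OF s] by (subst sum_ennreal) (auto intro!: ennreal_leI sum_mono mult_left_mono)
    also have "\<dots> \<le> (\<Sum>k\<in>UNIV. ennreal (p k s) * e2ennreal (h k s + ereal c))"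
    proof (rule sum_mono)
      fix k
      have "ennreal (max 0 (d k s + c)) = e2ennreal (ereal (d k s) + ereal c)"
        by (simp add: max.commute[of 0])
      also have "\<dots> \<le> e2ennreal (h k s + ereal c)"
        by (intro e2ennreal_mono add_right_mono le s)
      finally show "ennreal (p k s * max 0 (d k s + c)) \<le> ennreal (p k s) * e2ennreal (h k s + ereal c)"
        using p(1)[OF s] by (simp add: ennreal_mult mult_left_mono)
    qed
    finally show "ennreal (?D s) \<le> (\<Sum>k\<in>UNIV. ennreal (p k s) * e2ennreal (h k s + ereal c))" .
  qed
  finally have "enn2ereal (ennreal (integral\<^sup>L M ?D)) \<le>
      enn2ereal (\<integral>\<^sup>+ s. (\<Sum>k\<in>UNIV. ennreal (p k s) * e2ennreal (h k s + ereal c)) \<partial>M)"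
    by (simp add: less_eq_ennreal.rep_eq)
  moreover have "ereal (integral\<^sup>L M ?D) \<le> enn2ereal (ennreal (integral\<^sup>L M ?D))"
    by (cases "0 \<le> integral\<^sup>L M ?D") (auto simp: enn2ereal_ennreal ennreal_neg zero_ennreal.rep_eq)
  moreover have "integral\<^sup>L M ?D = (\<integral>s. (\<Sum>k\<in>UNIV. p k s * d k s) \<partial>M) + c * measure M (space M)"
    using int by simp
  ultimately show ?thesis
    by simp
qed

text \<open>Now \<open>- c \<le> h \<le> d\<close> gives \<open>d + c \<ge> 0\<close>, so passing to
  \<open>ennreal\<close> truncates nothing and the integral of the majorant is evaluated
  exactly.\<close>

lemma running_cost_upper_bound:
  fixes p d :: "'i::finite \<Rightarrow> 'a \<Rightarrow> real" and h :: "'i \<Rightarrow> 'a \<Rightarrow> ereal"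
  assumes "finite_measure M" and int: "integrable M (\<lambda>s. \<Sum>k\<in>UNIV. p k s * d k s)"
    and p: "\<And>k s. s \<in> space M \<Longrightarrow> 0 \<le> p k s" "\<And>s. s \<in> space M \<Longrightarrow> (\<Sum>k\<in>UNIV. p k s) = 1"
    and le: "\<And>k s. s \<in> space M \<Longrightarrow> h k s \<le> ereal (d k s)"
    and c: "\<And>k s. s \<in> space M \<Longrightarrow> ereal (- c) \<le> h k s"
  shows "enn2ereal (\<integral>\<^sup>+ s. (\<Sum>k\<in>UNIV. ennreal (p k s) * e2ennreal (h k s + ereal c)) \<partial>M)
    \<le> ereal ((\<integral>s. (\<Sum>k\<in>UNIV. p k s * d k s) \<partial>M) + c * measure M (space M))"
proof -
  interpret finite_measure M by fact
  let ?D = "\<lambda>s. (\<Sum>k\<in>UNIV. p k s * d k s) + c"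
  have int': "integrable M ?D"
    using int by simp
  have dc: "0 \<le> d k s + c" if "s \<in> space M" for k s
    using order_trans[OF c[OF that] le[OF that], of k] by simp
  have D_eq: "?D s = (\<Sum>k\<in>UNIV. p k s * (d k s + c))" if "s \<in> space M" for s
    using p(2)[OF that] by (simp add: distrib_left sum.distrib flip: sum_distrib_right)
  have D_nonneg: "0 \<le> ?D s" if "s \<in> space M" for s
    unfolding D_eq[OF that] using p(1) dc that by (auto intro!: sum_nonneg)
  have "(\<integral>\<^sup>+ s. (\<Sum>k\<in>UNIV. ennreal (p k s) * e2ennreal (h k s + ereal c)) \<partial>M) \<le> (\<integral>\<^sup>+ s. ennreal (?D s) \<partial>M)"
  proof (rule nn_integral_mono)
    fix s assume s: "s \<in> space M"
    have "(\<Sum>k\<in>UNIV. ennreal (p k s) * e2ennreal (h k s + ereal c)) \<le> (\<Sum>k\<in>UNIV. ennreal (p k s * (d k s + c)))"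
    proof (rule sum_mono)
      fix k
      have "e2ennreal (h k s + ereal c) \<le> e2ennreal (ereal (d k s) + ereal c)"
        by (intro e2ennreal_mono add_right_mono le s)
      also have "\<dots> = ennreal (d k s + c)"
        by simp
      finally show "ennreal (p k s) * e2ennreal (h k s + ereal c) \<le> ennreal (p k s * (d k s + c))"
        using p(1)[OF s] dc[OF s] by (simp add: ennreal_mult mult_left_mono)
    qed
    also have "\<dots> = ennreal (?D s)"
      unfolding D_eq[OF s] using p(1)[OF s] dc[OF s] by (intro sum_ennreal) simp
    finally show "(\<Sum>k\<in>UNIV. ennreal (p k s) * e2ennreal (h k s + ereal c)) \<le> ennreal (?D s)" .
  qed
  also have "\<dots> = ennreal (integral\<^sup>L M ?D)"
    by (rule nn_integral_eq_integral[OF int']) (use D_nonneg in auto)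
  finally have "enn2ereal (\<integral>\<^sup>+ s. (\<Sum>k\<in>UNIV. ennreal (p k s) * e2ennreal (h k s + ereal c)) \<partial>M) \<le>
      enn2ereal (ennreal (integral\<^sup>L M ?D))"
    by (simp add: less_eq_ennreal.rep_eq)
  moreover have "0 \<le> integral\<^sup>L M ?D"
    by (rule Bochner_Integration.integral_nonneg) (use D_nonneg in auto)
  moreover have "integral\<^sup>L M ?D = (\<integral>s. (\<Sum>k\<in>UNIV. p k s * d k s) \<partial>M) + c * measure M (space M)"
    using int by simp
  ultimately show ?thesis
    by (simp add: enn2ereal_ennreal)
qed

lemma controls_orthant:
  assumes "lam \<in> controls \<V> t T" "s \<in> {t..T}"
  shows "(\<lambda>j\<in>\<V> k. lam s k j) \<in> orthant (\<V> k)"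
  using assms by (auto simp: controls_def orthant_def)

text \<open>Entries off \<open>\<V> k\<close> are constantly \<open>undefined\<close>, so the tuple
  is measurable coordinatewise. Over the finite type of nodes the product sigma-algebra is the Borel
  one, which is what semicontinuity of \<open>L k\<close> calls for.\<close>

lemma controls_cost_measurable:
  fixes \<V> :: "'i::finite \<Rightarrow> 'i set"
  assumes lam: "lam \<in> controls \<V> t T" and lsc: "lower_semicontinuous_on (orthant (\<V> k)) (L k)"
  shows "(\<lambda>s. L k (\<lambda>j\<in>\<V> k. lam s k j)) \<in> borel_measurable (lebesgue_on {t..T})"
proof -
  let ?N = "lebesgue_on {t..T}"
  have [measurable]: "(\<lambda>s. lam s k j) \<in> borel_measurable ?N" if "j \<in> \<V> k" for j
    using lam that
    by (intro borel_measurable_integrable absolutely_integrable_imp_integrable) (auto simp: controls_def)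
  have "(\<lambda>s. (\<lambda>j\<in>\<V> k. lam s k j) j) \<in> borel_measurable ?N" for j
    by (cases "j \<in> \<V> k") simp_all
  then have "(\<lambda>s. \<lambda>j\<in>\<V> k. lam s k j) \<in> ?N \<rightarrow>\<^sub>M Pi\<^sub>M UNIV (\<lambda>_. borel)"
    by (intro measurable_PiM_single') auto
  then have "(\<lambda>s. \<lambda>j\<in>\<V> k. lam s k j) \<in> ?N \<rightarrow>\<^sub>M borel"
    by (simp only: measurable_cong_sets[OF refl sets_PiM_equal_borel])
  then have "(\<lambda>s. \<lambda>j\<in>\<V> k. lam s k j) \<in> ?N \<rightarrow>\<^sub>M restrict_space borel (orthant (\<V> k))"
    by (rule measurable_restrict_space2[rotated]) (use controls_orthant[OF lam] in auto)
  from measurable_compose[OF this lower_semicontinuous_on_borel_measurable[OF lsc]]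
  show ?thesis .
qed

lemma expected_payoff_bounds:
  fixes \<V> :: "'i::finite \<Rightarrow> 'i set" and V :: "'i \<Rightarrow> real \<Rightarrow> real"
  assumes irrefl: "\<And>k. k \<notin> \<V> k" and cost: "admissible_cost \<V> L"
    and prob: "prob_space M" and filt: "usual_filtration M F"
    and lam: "lam \<in> controls \<V> t T" and chain: "markov_chain_on M F \<V> t T i lam (X t i lam)"
    and tT: "t \<le> T" and r: "0 \<le> r" and VT: "\<And>j. V j T = g j"
    and V: "\<And>j s. s \<in> {t..T} \<Longrightarrow> (V j has_real_derivative V' j s) (at s within {t..T})"
    and V': "\<And>j. continuous_on {t..T} (V' j)"
    and ham: "\<And>k s. s \<in> {t..T} \<Longrightarrow>
      hamiltonian \<V> L k (\<lambda>j. V j s - V k s) = ereal (r * V k s - V' k s)"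
  shows "expected_payoff M \<V> L X T r g i t lam \<le> ereal (V i t)"
    and "\<lbrakk>0 \<le> \<epsilon>; \<And>k s. s \<in> {t..T} \<Longrightarrow> L k (\<lambda>j\<in>\<V> k. lam s k j) \<le>
          ereal ((\<Sum>j\<in>\<V> k. lam s k j * (V j s - V k s)) - (r * V k s - V' k s) + \<epsilon>)\<rbrakk>
      \<Longrightarrow> ereal (V i t - \<epsilon> * (T - t)) \<le> expected_payoff M \<V> L X T r g i t lam"
proof -
  let ?N = "lebesgue_on {t..T}"
  have fin: "finite_measure ?N"
    by (rule finite_measure_lebesgue_on) simp
  have N_space: "measure ?N {t..T} = T - t"
    using tT by (simp add: measure_restrict_space)
  obtain P where P: "transition_function \<V> t T lam P"
    and marg: "\<And>u j. u \<in> {t..T} \<Longrightarrow> measure M {\<omega> \<in> space M. X t i lam u \<omega> = j} = P t u i j"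
    using markov_chain_on_marginals[OF prob filt chain] by blast
  have P_pos: "0 \<le> P t s i k" and P_sum: "(\<Sum>k\<in>UNIV. P t s i k) = 1" if "s \<in> {t..T}" for s k
    using P that unfolding transition_function_def atLeastAtMost_iff by blast+
  define e where "e s = exp (- r * (s - t))" for s
  define W where "W j s = e s * V j s" for j s
  define W' where "W' j s = e s * (V' j s - r * V j s)" for j s
  define l where "l k s = L k (\<lambda>j\<in>\<V> k. lam s k j)" for k s
  define h where "h s k = ereal (e s) * l k s" for s k
  \<comment> \<open>By \<open>ham\<close> the subtracted term is the Hamiltonian, which makes
    \<open>d\<close> a minorant of the discounted cost. By \<open>d_eq\<close> it is also the Dynkin
    integrand of \<open>W\<close>; these two readings carry the whole argument.\<close>
  define d where "d k s = e s * ((\<Sum>j\<in>\<V> k. lam s k j * (V j s - V k s)) - (r * V k s - V' k s))" for k s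
  have e: "0 < e s" "e s \<le> 1" if "s \<in> {t..T}" for s
    using that r by (auto simp: e_def)
  have V_cont: "continuous_on {t..T} (V j)" for j
    using V by (meson DERIV_continuous_on)
  have W: "(W j has_real_derivative W' j s) (at s within {t..T})" if "s \<in> {t..T}" for j s
    unfolding W_def[abs_def] W'_def e_def
    by (rule derivative_eq_intros V[OF that] refl)+ (simp add: algebra_simps)
  have W'_cont: "continuous_on {t..T} (W' j)" for j
    unfolding W'_def[abs_def] e_def by (intro continuous_intros V_cont V')
  have d_eq: "d k s = W' k s + (\<Sum>j\<in>\<V> k. lam s k j * (W j s - W k s))" for k s
    by (simp add: d_def W_def W'_def algebra_simps sum_distrib_left flip: sum_subtractf)
  have dynkin: "integrable ?N (\<lambda>s. \<Sum>k\<in>UNIV. P t s i k * d k s)"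
    "(\<integral>s. (\<Sum>k\<in>UNIV. P t s i k * d k s) \<partial>?N) = (\<Sum>j\<in>UNIV. P t T i j * W j T) - W i t"
    unfolding d_eq
    by (rule transition_function_dynkin[where W = W and W' = W', OF irrefl tT P]; fact W W'_cont)+
  obtain C where C: "\<And>k x. x \<in> orthant (\<V> k) \<Longrightarrow> ereal C \<le> L k x"
    using cost unfolding admissible_cost_def by blast
  have orth: "(\<lambda>j\<in>\<V> k. lam s k j) \<in> orthant (\<V> k)" if "s \<in> {t..T}" for s k
    using controls_orthant[OF lam that] .
  \<comment> \<open>The bound is \<open>- \<bar>C\<bar>\<close> and not \<open>C\<close>, because
    discounting by \<open>e s \<le> 1\<close> lowers a positive bound but only raises a nonpositive
    one.\<close>
  have h_ge: "ereal (- \<bar>C\<bar>) \<le> h s k" if s: "s \<in> {t..T}" for s k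
  proof -
    have "- \<bar>C\<bar> \<le> e s * (- \<bar>C\<bar>)"
      using e[OF s] by (simp add: mult_left_le_one_le)
    then have "ereal (- \<bar>C\<bar>) \<le> ereal (e s) * ereal (- \<bar>C\<bar>)"
      by simp
    also have "\<dots> \<le> h s k"
      unfolding h_def l_def
      by (rule ereal_mult_left_mono) (use e[OF s] C[OF orth[OF s, of k]] in \<open>auto elim: order_trans[rotated]\<close>)
    finally show ?thesis .
  qed
  have h_meas: "(\<lambda>s. h s k) \<in> borel_measurable ?N" for k
  proof -
    have [measurable]: "(\<lambda>s. L k (\<lambda>j\<in>\<V> k. lam s k j)) \<in> borel_measurable ?N"
      using cost by (intro controls_cost_measurable lam) (simp add: admissible_cost_def)
    have [measurable]: "e \<in> borel_measurable ?N"
      unfolding e_def[abs_def]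
      by (intro continuous_imp_measurable_on_sets_lebesgue continuous_intros) simp
    show ?thesis
      unfolding h_def l_def by measurable
  qed
  define Z where "Z = (\<integral>\<^sup>+ s. (\<Sum>k\<in>UNIV. ennreal (P t s i k) * e2ennreal (h s k + ereal \<bar>C\<bar>)) \<partial>?N)"
  have payoff: "expected_payoff M \<V> L X T r g i t lam =
      ereal ((\<Sum>j\<in>UNIV. P t T i j * W j T) + \<bar>C\<bar> * (T - t)) - enn2ereal Z"
  proof -
    have "expected_payoff M \<V> L X T r g i t lam =
      quasi_integral M (\<lambda>\<omega>. - quasi_integral ?N (\<lambda>s. h s (X t i lam s \<omega>)) + ereal (W (X t i lam T \<omega>) T))"
      by (simp add: expected_payoff_def h_def l_def e_def W_def VT)
    also have "\<dots> = ereal ((\<Sum>j\<in>UNIV. measure M {\<omega> \<in> space M. X t i lam T \<omega> = j} * W j T) + \<bar>C\<bar> * (T - t))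
      - enn2ereal (\<integral>\<^sup>+ s. (\<Sum>j\<in>UNIV. ennreal (measure M {\<omega> \<in> space M. X t i lam s \<omega> = j}) *
          e2ennreal (h s j + ereal \<bar>C\<bar>)) \<partial>?N)"
    proof (rule expected_payoff_marginals[OF prob tT])
      show "AE \<omega> in M. cadlag_discrete_on t T (\<lambda>s. X t i lam s \<omega>)"
        using chain by (simp add: markov_chain_on_def)
    qed (use markov_chain_on_measurable[OF filt chain] h_meas h_ge in auto)
    also have "(\<integral>\<^sup>+ s. (\<Sum>j\<in>UNIV. ennreal (measure M {\<omega> \<in> space M. X t i lam s \<omega> = j}) *
          e2ennreal (h s j + ereal \<bar>C\<bar>)) \<partial>?N) = Z"
      unfolding Z_def by (rule nn_integral_cong) (simp add: marg)
    finally show ?thesis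
      using tT by (simp add: marg)
  qed
  \<comment> \<open>Fenchel's inequality: the tuple of rates is one competitor in the supremum
    defining the Hamiltonian.\<close>
  have d_le: "ereal (d k s) \<le> h s k" if s: "s \<in> {t..T}" for k s
  proof -
    have "ereal (\<Sum>j\<in>\<V> k. (\<lambda>j\<in>\<V> k. lam s k j) j * (V j s - V k s)) - l k s \<le>
        hamiltonian \<V> L k (\<lambda>j. V j s - V k s)"
      unfolding hamiltonian_def l_def by (rule SUP_upper[OF orth[OF s]])
    then have "ereal ((\<Sum>j\<in>\<V> k. lam s k j * (V j s - V k s)) - (r * V k s - V' k s)) \<le> l k s"
      unfolding ham[OF s] by (cases "l k s") auto
    from ereal_mult_left_mono[OF this, of "ereal (e s)"] show ?thesis
      using e[OF s] by (simp add: d_def h_def)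
  qed
  \<comment> \<open>The terms \<open>\<bar>C\<bar> * (T - t)\<close> and the terminal sum occur in
    \<open>payoff\<close> as well, so only \<open>W i t\<close> survives the subtraction.\<close>
  have "ereal ((\<Sum>j\<in>UNIV. P t T i j * W j T) - W i t + \<bar>C\<bar> * (T - t)) \<le> enn2ereal Z"
    using running_cost_lower_bound[OF fin dynkin(1), of "\<lambda>k s. h s k" "\<bar>C\<bar>"]
    by (simp add: Z_def N_space dynkin(2) P_pos P_sum d_le)
  moreover have Wt: "W i t = V i t"
    by (simp add: W_def e_def)
  ultimately show "expected_payoff M \<V> L X T r g i t lam \<le> ereal (V i t)"
    unfolding payoff by (cases Z) (auto simp: enn2ereal_ennreal)
  assume \<epsilon>: "0 \<le> \<epsilon>"
    and opt: "\<And>k s. s \<in> {t..T} \<Longrightarrow> L k (\<lambda>j\<in>\<V> k. lam s k j) \<le>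
      ereal ((\<Sum>j\<in>\<V> k. lam s k j * (V j s - V k s)) - (r * V k s - V' k s) + \<epsilon>)"
  have h_le: "h s k \<le> ereal (d k s + \<epsilon>)" if s: "s \<in> {t..T}" for k s
  proof -
    have "h s k \<le> ereal (e s) * ereal ((\<Sum>j\<in>\<V> k. lam s k j * (V j s - V k s)) - (r * V k s - V' k s) + \<epsilon>)"
      unfolding h_def l_def by (rule ereal_mult_left_mono[OF opt[OF s]]) (use e[OF s] in simp)
    also have "\<dots> = ereal (d k s + e s * \<epsilon>)"
      by (simp add: d_def distrib_left)
    also have "\<dots> \<le> ereal (d k s + \<epsilon>)"
      using e[OF s] \<epsilon> by (simp add: mult_left_le_one_le)
    finally show ?thesis .
  qed
  have sum_eq: "(\<Sum>k\<in>UNIV. P t s i k * (d k s + \<epsilon>)) = (\<Sum>k\<in>UNIV. P t s i k * d k s) + \<epsilon>"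
    if "s \<in> {t..T}" for s
    using P_sum[OF that] by (simp add: distrib_left sum.distrib flip: sum_distrib_right)
  interpret N: finite_measure ?N by fact
  have "integrable ?N (\<lambda>s. (\<Sum>k\<in>UNIV. P t s i k * d k s) + \<epsilon>)"
    using dynkin(1) by simp
  then have int: "integrable ?N (\<lambda>s. \<Sum>k\<in>UNIV. P t s i k * (d k s + \<epsilon>))"
    by (rule Bochner_Integration.integrable_cong[THEN iffD1, rotated -1]) (simp_all add: sum_eq)
  have "(\<integral>s. (\<Sum>k\<in>UNIV. P t s i k * (d k s + \<epsilon>)) \<partial>?N) = (\<integral>s. (\<Sum>k\<in>UNIV. P t s i k * d k s) + \<epsilon> \<partial>?N)"
    by (rule Bochner_Integration.integral_cong) (simp_all add: sum_eq)
  also have "\<dots> = (\<Sum>j\<in>UNIV. P t T i j * W j T) - W i t + \<epsilon> * (T - t)"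
    using dynkin by (simp add: N_space)
  finally have "enn2ereal Z \<le> ereal ((\<Sum>j\<in>UNIV. P t T i j * W j T) - W i t + \<epsilon> * (T - t) + \<bar>C\<bar> * (T - t))"
    using running_cost_upper_bound[OF fin int, of "\<lambda>k s. h s k" "\<bar>C\<bar>"]
    by (simp add: Z_def N_space P_pos P_sum h_le h_ge)
  then show "ereal (V i t - \<epsilon> * (T - t)) \<le> expected_payoff M \<V> L X T r g i t lam"
    unfolding payoff Wt by (cases Z) (auto simp: enn2ereal_ennreal)
qed

subsection \<open>Optimal and nearly optimal controls\<close>

text \<open>
  A nearly optimal tuple of rates at one time remains so on a neighbourhood of it, so that compactness of the
  time interval gives a piecewise constant control and no measurable selection is needed.
\<close>

lemma ex_nearly_optimal_control:
  fixes \<V> :: "'i::finite \<Rightarrow> 'i set" and V R :: "'i \<Rightarrow> real \<Rightarrow> real"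
  assumes tT: "t \<le> T" and \<epsilon>: "0 < \<epsilon>"
    and V: "\<And>k. continuous_on {t..T} (V k)" and R: "\<And>k. continuous_on {t..T} (R k)"
    and L: "\<And>k x. x \<in> orthant (\<V> k) \<Longrightarrow> L k x \<noteq> - \<infinity>"
    and ham: "\<And>k s. s \<in> {t..T} \<Longrightarrow> hamiltonian \<V> L k (\<lambda>j. V j s - V k s) = ereal (R k s)"
  shows "\<exists>lam\<in>controls \<V> t T. \<forall>k. \<forall>s\<in>{t..T}. L k (\<lambda>j\<in>\<V> k. lam s k j) \<le>
    ereal ((\<Sum>j\<in>\<V> k. lam s k j * (V j s - V k s)) - R k s + \<epsilon>)"
proof -
  define good where "good lam s \<longleftrightarrow> (\<forall>k. L k (\<lambda>j\<in>\<V> k. lam s k j) \<le>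
    ereal ((\<Sum>j\<in>\<V> k. lam s k j * (V j s - V k s)) - R k s + \<epsilon>))" for lam s
  \<comment> \<open>Measurability on the whole line and a uniform bound survive splicing at a point,
    and together give integrability on \<open>{t..T}\<close>.\<close>
  define regular where "regular lam B \<longleftrightarrow> (\<forall>k. \<forall>j\<in>\<V> k. (\<lambda>s. lam s k j) \<in> borel_measurable borel \<and>
    (\<forall>s. 0 \<le> lam s k j \<and> lam s k j \<le> B))" for lam :: "real \<Rightarrow> 'i \<Rightarrow> 'i \<Rightarrow> real" and B
  \<comment> \<open>The guards are needed because the bisection principle \<open>Bolzano\<close>
    also tests small intervals that stick out of \<open>{t..T}\<close>.\<close>
  define Q where "Q a b \<longleftrightarrow> (t \<le> a \<longrightarrow> b \<le> T \<longrightarrow>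
    (\<exists>lam B. regular lam B \<and> (\<forall>s\<in>{a..b}. good lam s)))" for a b
  have "Q t T"
    using tT
  proof (induction rule: Bolzano)
    case (trans a b c)
    show ?case
      unfolding Q_def
    proof (intro impI)
      assume "t \<le> a" "c \<le> T"
      then obtain lam1 B1 lam2 B2 where reg: "regular lam1 B1" "regular lam2 B2"
        and good1: "\<And>s. s \<in> {a..b} \<Longrightarrow> good lam1 s" and good2: "\<And>s. s \<in> {b..c} \<Longrightarrow> good lam2 s"
        using trans unfolding Q_def by (meson order_trans)
      \<comment> \<open>At the junction \<open>b\<close> both pieces are good, so either value may
        be kept there.\<close>
      define lam where "lam s = (if s \<le> b then lam1 s else lam2 s)" for s
      have "(\<lambda>s. lam s k j) \<in> borel_measurable borel" if "j \<in> \<V> k" for k j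
      proof -
        have [measurable]: "(\<lambda>s. lam1 s k j) \<in> borel_measurable borel" "(\<lambda>s. lam2 s k j) \<in> borel_measurable borel"
          using reg that by (auto simp: regular_def)
        have "(\<lambda>s. if s \<le> b then lam1 s k j else lam2 s k j) \<in> borel_measurable borel"
          by measurable
        then show ?thesis
          by (simp add: lam_def if_distrib[of "\<lambda>f. f k j"])
      qed
      moreover have "0 \<le> lam s k j \<and> lam s k j \<le> max B1 B2" if "j \<in> \<V> k" for s k j
        using reg that by (auto simp: regular_def lam_def le_max_iff_disj)
      moreover have "good lam s" if "s \<in> {a..c}" for s
        using good1[of s] good2[of s] that by (auto simp: lam_def good_def)
      ultimately have "regular lam (max B1 B2)" "\<forall>s\<in>{a..c}. good lam s"
        by (auto simp: regular_def)
      then show "\<exists>lam B. regular lam B \<and> (\<forall>s\<in>{a..c}. good lam s)"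
        by blast
    qed
  next
    case (local x)
    then have x: "x \<in> {t..T}" by simp
    have "\<exists>y\<in>orthant (\<V> k). ereal (R k x - \<epsilon>) < ereal (\<Sum>j\<in>\<V> k. y j * (V j x - V k x)) - L k y" for k
    proof -
      have "ereal (R k x - \<epsilon>) < hamiltonian \<V> L k (\<lambda>j. V j x - V k x)"
        unfolding ham[OF x] using \<epsilon> by simp
      then show ?thesis
        unfolding hamiltonian_def less_SUP_iff .
    qed
    then obtain y where y: "\<And>k. y k \<in> orthant (\<V> k)"
      "\<And>k. ereal (R k x - \<epsilon>) < ereal (\<Sum>j\<in>\<V> k. y k j * (V j x - V k x)) - L k (y k)"
      by metis
    define l where "l k = real_of_ereal (L k (y k))" for k
    \<comment> \<open>A cost of \<open>\<infinity>\<close> would make the competitor's value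
      \<open>-\<infinity>\<close>, contradicting the strict bound in \<open>y(2)\<close>.\<close>
    have l: "L k (y k) = ereal (l k)" for k
      using y(2)[of k] L[OF y(1)[of k]] unfolding l_def by (cases "L k (y k)") auto
    define m where "m k s = (\<Sum>j\<in>\<V> k. y k j * (V j s - V k s)) - R k s + \<epsilon>" for k s
    \<comment> \<open>The inequality at \<open>x\<close> is strict and \<open>m k\<close> is
      continuous, so it persists nearby; finitely many nodes allow one common radius.\<close>
    have "\<forall>\<^sub>F s in at x within {t..T}. \<forall>k. l k < m k s"
    proof (rule eventually_all_finite)
      fix k
      have "continuous_on {t..T} (m k)"
        unfolding m_def[abs_def] by (intro continuous_intros V R)
      then have "(m k \<longlongrightarrow> m k x) (at x within {t..T})"
        using x by (simp add: continuous_on_def)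
      moreover have "l k < m k x"
        using y(2)[of k] unfolding l m_def by simp
      ultimately show "\<forall>\<^sub>F s in at x within {t..T}. l k < m k s"
        by (rule order_tendstoD(1))
    qed
    then obtain \<delta> where \<delta>: "\<delta> > 0" "\<And>s k. s \<in> {t..T} \<Longrightarrow> s \<noteq> x \<Longrightarrow> dist s x < \<delta> \<Longrightarrow> l k < m k s"
      unfolding eventually_at by auto
    have lm: "l k < m k s" if "s \<in> {t..T}" "\<bar>s - x\<bar> < \<delta>" for s k
      using \<delta>(2)[of s k] y(2)[of k] that unfolding l by (cases "s = x") (auto simp: m_def dist_real_def)
    have res: "(\<lambda>j\<in>\<V> k. y k j) = y k" for k
      using y(1)[of k] unfolding orthant_def by (metis PiE_restrict)
    have "Q a b" if "a \<le> x \<and> x \<le> b \<and> b - a < \<delta>" for a b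
      unfolding Q_def regular_def
    proof (intro impI exI conjI allI ballI)
      assume ab: "t \<le> a" "b \<le> T"
      fix k j assume j: "j \<in> \<V> k"
      show "(\<lambda>s. (\<lambda>s. y) s k j) \<in> borel_measurable borel"
        by simp
      show "0 \<le> (\<lambda>s. y) s k j" for s :: real
        using y(1)[of k] j by (auto simp: orthant_def)
      have "y k j \<le> (\<Sum>j\<in>\<V> k. \<bar>y k j\<bar>)"
        using member_le_sum[of j "\<V> k" "\<lambda>j. \<bar>y k j\<bar>"] j by simp
      also have "\<dots> \<le> (\<Sum>k\<in>UNIV. \<Sum>j\<in>\<V> k. \<bar>y k j\<bar>)"
        by (rule member_le_sum) (auto intro: sum_nonneg)
      finally show "(\<lambda>s. y) s k j \<le> (\<Sum>k\<in>UNIV. \<Sum>j\<in>\<V> k. \<bar>y k j\<bar>)" for s :: real .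
    next
      fix s assume "t \<le> a" "b \<le> T" "s \<in> {a..b}"
      then have "l k < m k s" for k
        using that by (intro lm) auto
      then show "good (\<lambda>s. y) s"
        unfolding good_def by (auto simp: res l m_def less_imp_le)
    qed
    with \<delta>(1) show ?case
      by blast
  qed
  then obtain lam B where reg: "regular lam B" and good: "\<And>s. s \<in> {t..T} \<Longrightarrow> good lam s"
    unfolding Q_def by blast
  have "(\<lambda>s. lam s k j) absolutely_integrable_on {t..T}" if "j \<in> \<V> k" for k j
  proof (rule measurable_bounded_by_integrable_imp_absolutely_integrable)
    show "(\<lambda>s. lam s k j) \<in> borel_measurable (lebesgue_on {t..T})"
      using reg that by (intro measurable_restrict_space1 measurable_completion) (simp add: regular_def)
    show "norm (lam s k j) \<le> B" for s
      using reg that by (simp add: regular_def)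
  qed auto
  then have "lam \<in> controls \<V> t T"
    using reg by (auto simp: controls_def regular_def)
  with good show ?thesis
    unfolding good_def by blast
qed

theorem theorem2:
  fixes \<V> :: "'i::finite \<Rightarrow> 'i set"
    and L :: "'i \<Rightarrow> ('i \<Rightarrow> real) \<Rightarrow> ereal"
    and M :: "'w measure"
    and F :: "real \<Rightarrow> 'w measure"
    and X :: "real \<Rightarrow> 'i \<Rightarrow> (real \<Rightarrow> 'i \<Rightarrow> 'i \<Rightarrow> real) \<Rightarrow> real \<Rightarrow> 'w \<Rightarrow> 'i"
    and T r :: real
    and g :: "'i \<Rightarrow> real"
    and V :: "'i \<Rightarrow> real \<Rightarrow> real"
  assumes graph: "strongly_connected_digraph \<V>"
    and cost: "admissible_cost \<V> L"
    and prob: "prob_space M"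
    and filt: "usual_filtration M F"
    and chain: "\<And>t i lam. t \<in> {0..T} \<Longrightarrow> lam \<in> controls \<V> t T \<Longrightarrow>
                  markov_chain_on M F \<V> t T i lam (X t i lam)"
    and T: "0 < T" and r: "0 \<le> r"
    and V: "hjb_solution \<V> L T r g V"
  shows "(\<forall>i. \<forall>t\<in>{0..T}. value_function M \<V> L X T r g i t = ereal (V i t)) \<and>
    (\<forall>lam\<in>controls \<V> 0 T.
       (\<forall>k. \<forall>t\<in>{0..T}.
          is_arg_max
            (\<lambda>x. (\<Sum>j\<in>\<V> k. ereal (x j) *
                    (value_function M \<V> L X T r g j t - value_function M \<V> L X T r g k t)) - L k x)
            (\<lambda>x. x \<in> orthant (\<V> k))
            (\<lambda>j\<in>\<V> k. lam t k j))
       \<longrightarrow> (\<forall>i. expected_payoff M \<V> L X T r g i 0 lam =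
                (SUP mu\<in>controls \<V> 0 T. expected_payoff M \<V> L X T r g i 0 mu)))"
proof -
  obtain V' where V'_cont: "\<And>i. continuous_on {..T} (V' i)"
    and V_deriv: "\<And>i t. t \<le> T \<Longrightarrow> (V i has_real_derivative V' i t) (at t within {..T})"
    and hjb: "\<And>i t. t \<le> T \<Longrightarrow> ereal (V' i t - r * V i t) + hamiltonian \<V> L i (\<lambda>j. V j t - V i t) = 0"
    and VT: "\<And>i. V i T = g i"
    using V unfolding hjb_solution_def by blast
  have irrefl: "k \<notin> \<V> k" for k
    using graph by (simp add: strongly_connected_digraph_def)
  \<comment> \<open>The equation in \<open>ereal\<close> itself forces finiteness: an infinite
    Hamiltonian plus a real number cannot be \<open>0\<close>.\<close>
  have ham: "hamiltonian \<V> L k (\<lambda>j. V j s - V k s) = ereal (r * V k s - V' k s)" if "s \<le> T" for k s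
    using hjb[OF that, of k] by (cases "hamiltonian \<V> L k (\<lambda>j. V j s - V k s)") (auto simp: zero_ereal_def)
  have V'_Icc: "continuous_on {t..T} (V' j)" for t j
    by (rule continuous_on_subset[OF V'_cont]) auto
  have V_Icc: "(V j has_real_derivative V' j s) (at s within {t..T})" if "s \<in> {t..T}" for t j s
    by (rule DERIV_subset[OF V_deriv]) (use that in auto)
  have V_cont: "continuous_on {t..T} (V j)" for t j
    using V_Icc by (meson DERIV_continuous_on)
  have upper: "expected_payoff M \<V> L X T r g i t lam \<le> ereal (V i t)"
    if "t \<in> {0..T}" "lam \<in> controls \<V> t T" for i t lam
    by (rule expected_payoff_bounds(1)[where V = V and V' = V' and X = X,
          OF irrefl cost prob filt that(2) chain[OF that]])
      (use that r VT V_Icc V'_Icc ham in auto)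
  have lower: "ereal (V i t - \<epsilon> * (T - t)) \<le> expected_payoff M \<V> L X T r g i t lam"
    if "t \<in> {0..T}" "lam \<in> controls \<V> t T" "0 \<le> \<epsilon>"
      "\<And>k s. s \<in> {t..T} \<Longrightarrow> L k (\<lambda>j\<in>\<V> k. lam s k j) \<le>
        ereal ((\<Sum>j\<in>\<V> k. lam s k j * (V j s - V k s)) - (r * V k s - V' k s) + \<epsilon>)" for i t lam \<epsilon>
    by (rule expected_payoff_bounds(2)[where V = V and V' = V' and X = X and \<epsilon> = \<epsilon>,
          OF irrefl cost prob filt that(2) chain[OF that(1,2)]])
      (use that r VT V_Icc V'_Icc ham in auto)
  have value_eq: "value_function M \<V> L X T r g i t = ereal (V i t)" if t: "t \<in> {0..T}" for i t
    unfolding value_function_def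
  proof (rule antisym)
    show "(SUP lam\<in>controls \<V> t T. expected_payoff M \<V> L X T r g i t lam) \<le> ereal (V i t)"
      using upper[OF t] by (rule SUP_least)
    show "ereal (V i t) \<le> (SUP lam\<in>controls \<V> t T. expected_payoff M \<V> L X T r g i t lam)"
    proof (rule ereal_le_epsilon2)
      fix \<eta> :: real assume "0 < \<eta>"
      \<comment> \<open>A pointwise error \<open>\<epsilon>\<close> costs at most
        \<open>\<epsilon> * (T - t)\<close> in the payoff; the \<open>+ 1\<close> keeps the
        denominator positive at \<open>t = T\<close>.\<close>
      define \<epsilon> where "\<epsilon> = \<eta> / (T - t + 1)"
      have \<epsilon>: "0 < \<epsilon>" "\<epsilon> * (T - t) \<le> \<eta>"
        using t \<open>0 < \<eta>\<close> by (auto simp: \<epsilon>_def field_simps)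
      have "\<exists>lam\<in>controls \<V> t T. \<forall>k. \<forall>s\<in>{t..T}. L k (\<lambda>j\<in>\<V> k. lam s k j) \<le>
          ereal ((\<Sum>j\<in>\<V> k. lam s k j * (V j s - V k s)) - (r * V k s - V' k s) + \<epsilon>)"
        using t \<epsilon>(1) cost ham
        by (intro ex_nearly_optimal_control continuous_intros V_cont V'_Icc) (auto simp: admissible_cost_def)
      then obtain lam where lam: "lam \<in> controls \<V> t T"
        and opt: "\<And>k s. s \<in> {t..T} \<Longrightarrow> L k (\<lambda>j\<in>\<V> k. lam s k j) \<le>
          ereal ((\<Sum>j\<in>\<V> k. lam s k j * (V j s - V k s)) - (r * V k s - V' k s) + \<epsilon>)"
        by blast
      have "ereal (V i t) \<le> ereal (V i t - \<epsilon> * (T - t)) + ereal \<eta>"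
        using \<epsilon>(2) by simp
      also have "\<dots> \<le> expected_payoff M \<V> L X T r g i t lam + ereal \<eta>"
        using \<epsilon>(1) by (intro add_right_mono lower[OF t lam _ opt]) simp_all
      also have "\<dots> \<le> (SUP lam\<in>controls \<V> t T. expected_payoff M \<V> L X T r g i t lam) + ereal \<eta>"
        by (intro add_right_mono SUP_upper lam)
      finally show "ereal (V i t) \<le> (SUP lam\<in>controls \<V> t T. expected_payoff M \<V> L X T r g i t lam) + ereal \<eta>" .
    qed
  qed
  have optimal: "expected_payoff M \<V> L X T r g i 0 lam = ereal (V i 0)"
    if lam: "lam \<in> controls \<V> 0 T"
      and argmax: "\<And>k s. s \<in> {0..T} \<Longrightarrow> is_arg_max
            (\<lambda>x. (\<Sum>j\<in>\<V> k. ereal (x j) *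
                    (value_function M \<V> L X T r g j s - value_function M \<V> L X T r g k s)) - L k x)
            (\<lambda>x. x \<in> orthant (\<V> k)) (\<lambda>j\<in>\<V> k. lam s k j)" for i lam
  proof (rule antisym)
    show "expected_payoff M \<V> L X T r g i 0 lam \<le> ereal (V i 0)"
      using upper lam T by simp
    \<comment> \<open>By \<open>value_eq\<close> the maximised expression is the one in the
      Hamiltonian, so a maximiser attains the supremum. As that is finite, so is the cost there, and
      \<open>lower\<close> applies with error \<open>0\<close>.\<close>
    have "L k (\<lambda>j\<in>\<V> k. lam s k j) \<le>
        ereal ((\<Sum>j\<in>\<V> k. lam s k j * (V j s - V k s)) - (r * V k s - V' k s) + 0)"
      if s: "s \<in> {0..T}" for k s
    proof -
      let ?x = "\<lambda>j\<in>\<V> k. lam s k j"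
      have "hamiltonian \<V> L k (\<lambda>j. V j s - V k s) \<le> ereal (\<Sum>j\<in>\<V> k. ?x j * (V j s - V k s)) - L k ?x"
        unfolding hamiltonian_def
        using argmax[OF s, of k] by (intro SUP_least) (auto simp: is_arg_max_def value_eq[OF s] not_less)
      then show ?thesis
        using s by (cases "L k ?x") (auto simp: ham)
    qed
    from lower[OF _ lam order_refl this, of i] show "ereal (V i 0) \<le> expected_payoff M \<V> L X T r g i 0 lam"
      using T by simp
  qed
  have "(SUP mu\<in>controls \<V> 0 T. expected_payoff M \<V> L X T r g i 0 mu) = ereal (V i 0)" for i
    using value_eq[of 0 i] T by (simp add: value_function_def)
  with value_eq optimal show ?thesis
    by simp
qed

end
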